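(* Let $d\ge 2$ and $n\ge 1$ be integers, and let $X=(X_1,\dots,X_n)$ be a vector of independent random variables taking values in a measurable space $\mathcal{X}$. Let $C=(C_{ij})_{d\times d}$ be a positive definite (symmetric real) matrix and let $Y$ be a centered $d$-dimensional Gaussian vector with covariance matrix $C$. Let $F=(F_1,\dots,F_d)$ be an $\mathbb{R}^d$-valued random vector, each $F_i=F_i(X_1,\dots,X_n)$ being a measurable real-valued function of $X$, such that $E[F_i]=0$ and $\sigma_{ij}:=E[F_iF_j]<\infty$ for all $1\le i,j\le d$. Then, for any $\alpha\in[0,1]$ and any $g\in\mathcal{C}^2(\mathbb{R}^d)$ with $\|g\|_{Lip}+M_2(g)<\infty$, $$|E[g(F)]-E[g(Y)]|\le B_1\Big(\sum_{i,j=1}^d E|C_{ij}-Z^{(\alpha)}_{ij}|^2\Big)^{1/2}+B_2\sum_{i=1}^d\sum_{k=1}^n E|\mathfrak{D}_kF_i|^3$$ $$\le B_1\sum_{i,j=1}^d|C_{ij}-\sigma_{ij}|+B_1\sum_{i,j=1}^d\sqrt{\mathrm{Var}(Z^{(\alpha)}_{ij})}+B_2\sum_{i=1}^d\sum_{k=1}^n E|\mathfrak{D}_kF_i|^3,$$ where $B_1:=\|C^{-1}\|_{op}\|C\|_{op}^{1/2}\|g\|_{Lip}$, $B_2:=\frac{\sqrt{2\pi}}{4}\|C^{-1}\|_{op}^{3/2}\|C\|_{op}M_2(g)\,d^2$, and $$Z^{(\alpha)}_{ij}:=\sum_{k=1}^n \mathfrak{D}_kF_i\,\mathfrak{D}^{(\alpha)}_kF_j,\qquad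 1\le i,j\le d.$$
   Context: For an integrable random variable $U=U(X_1,\dots,X_n)$, $E_i[U]$ denotes the expectation with respect to $X_i$ only, i.e. $E_i[U]=E[U\mid\sigma(X_k,k\ne i)]$, and $\mathfrak{D}_iU:=U-E_i[U]$, $1\le i\le n$. Let $\mathcal{F}_i:=\sigma(X_k,k\le i)$ and $\mathcal{G}_i:=\sigma(X_k,k\ge i)$ for $1\le i\le n$. For $\alpha\in[0,1]$, $\mathfrak{D}^{(\alpha)}_iU:=\alpha E[\mathfrak{D}_iU\mid\mathcal{F}_i]+(1-\alpha)E[\mathfrak{D}_iU\mid\mathcal{G}_i]$. $\|A\|_{op}:=\sup_{\|x\|=1}\|Ax\|$ is the operator norm with respect to the Euclidean norm $\|\cdot\|$ on $\mathbb{R}^d$. $\mathcal{C}^2(\mathbb{R}^d)$ is the space of twice continuously differentiable real-valued functions. $\|g\|_{Lip}:=\sup_{x\ne y}\frac{|g(x)-g(y)|}{\|x-y\|}$ and $M_2(g):=\sup_{x\ne y}\frac{\|\nabla g(x)-\nabla g(y)\|}{\|x-y\|}$. Convention: the right-hand sides take values in $[0,\infty]$ (with the variance of a non-square-integrable variable equal to $+\infty$); a bound is considered to hold trivially when its right-hand side is not finite. *)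

theory Defs
  imports "HOL-Probability.Probability"
begin

text \<open>
  Quantities that may be infinite live in \<^typ>\<open>ennreal\<close>, where \<open>0 * \<infinity> = 0\<close>; since
  every extended real is at most \<open>\<infinity>\<close>, a bound with an infinite right-hand side holds trivially.
\<close>

definition ennsqrt :: "ennreal \<Rightarrow> ennreal" where
  "ennsqrt x = (if x = \<top> then \<top> else ennreal (sqrt (enn2real x)))"

text \<open>
  The variance with values in \<open>[0,\<infinity>]\<close>. On a probability space it is \<open>\<infinity>\<close> for every
  random variable that is not square-integrable (if \<open>U\<close> is not even integrable, the Bochner
  integral of \<open>U\<close> is \<open>0\<close> and the value is the infinite second moment).
\<close>

definition evariance :: "'a measure \<Rightarrow> ('a \<Rightarrow> real) \<Rightarrow> ennreal" where
  "evariance M U = (\<integral>\<^sup>+ \<omega>. ennreal ((U \<omega> - integral\<^sup>L M U)\<^sup>2) \<partial>M)"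


section \<open>Matrices, smooth functions, Lipschitz constants\<close>

definition positive_definite :: "real ^ 'd ^ 'd \<Rightarrow> bool" where
  "positive_definite C \<longleftrightarrow> transpose C = C \<and> (\<forall>x. x \<noteq> 0 \<longrightarrow> 0 < x \<bullet> (C *v x))"

definition opnorm :: "real ^ 'd ^ 'd \<Rightarrow> real" where
  "opnorm A = onorm (\<lambda>x. A *v x)"

definition gradient :: "(real ^ 'd \<Rightarrow> real) \<Rightarrow> real ^ 'd \<Rightarrow> real ^ 'd" where
  "gradient g x = (\<chi> i. frechet_derivative g (at x) (axis i 1))"

definition twice_cont_diff :: "(real ^ 'd \<Rightarrow> real) \<Rightarrow> bool" where
  "twice_cont_diff g \<longleftrightarrow>
     (\<forall>x. g differentiable (at x)) \<and>
     (\<forall>x. gradient g differentiable (at x)) \<and>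
     continuous_on UNIV (\<lambda>x. jacobian (gradient g) (at x))"

definition lip_const :: "('a::real_normed_vector \<Rightarrow> 'b::real_normed_vector) \<Rightarrow> ennreal" where
  "lip_const f = (SUP (x, y)\<in>{(x, y). x \<noteq> y}. ennreal (norm (f x - f y) / norm (x - y)))"

definition M2 :: "(real ^ 'd \<Rightarrow> real) \<Rightarrow> ennreal" where
  "M2 g = lip_const (gradient g)"


section \<open>Gaussian vectors\<close>

definition std_gaussian :: "(real ^ 'd) measure" where
  "std_gaussian = density lborel (\<lambda>z. ennreal (\<Prod>i\<in>UNIV. std_normal_density (z $ i)))"

text \<open>
  A Gaussian vector is one distributed as an affine image of a vector of independent standard
  normal variables. Singular matrices \<open>A\<close> are allowed, so degenerate Gaussian vectors are included.
\<close>

definition gaussian_vector :: "'a measure \<Rightarrow> ('a \<Rightarrow> real ^ 'd) \<Rightarrow> bool" where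
  "gaussian_vector N Y \<longleftrightarrow> Y \<in> borel_measurable N \<and>
     (\<exists>(A :: real ^ 'd ^ 'd) m. distr N borel Y = distr std_gaussian borel (\<lambda>z. A *v z + m))"

definition centered :: "'a measure \<Rightarrow> ('a \<Rightarrow> real ^ 'd) \<Rightarrow> bool" where
  "centered N Y \<longleftrightarrow> (\<forall>i. integral\<^sup>L N (\<lambda>\<omega>. Y \<omega> $ i) = 0)"

definition has_covariance_matrix :: "'a measure \<Rightarrow> ('a \<Rightarrow> real ^ 'd) \<Rightarrow> real ^ 'd ^ 'd \<Rightarrow> bool" where
  "has_covariance_matrix N Y C \<longleftrightarrow>
     (\<forall>i j. integral\<^sup>L N (\<lambda>\<omega>. (Y \<omega> $ i - integral\<^sup>L N (\<lambda>\<omega>. Y \<omega> $ i)) *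
                            (Y \<omega> $ j - integral\<^sup>L N (\<lambda>\<omega>. Y \<omega> $ j))) = C $ i $ j)"


section \<open>Difference operators\<close>

text \<open>
  \<open>sigma_gen M S X K\<close> is the \<open>\<sigma>\<close>-algebra generated by the variables \<open>X k\<close>, \<open>k \<in> K\<close>, with values
  in the measurable space \<open>S\<close>. For \<open>K = {}\<close> it is the trivial \<open>\<sigma>\<close>-algebra on \<^term>\<open>space M\<close>.
\<close>

definition sigma_gen ::
    "'a measure \<Rightarrow> 'x measure \<Rightarrow> (nat \<Rightarrow> 'a \<Rightarrow> 'x) \<Rightarrow> nat set \<Rightarrow> 'a measure" where
  "sigma_gen M S X K = sigma (space M) {X k -` B \<inter> space M | k B. k \<in> K \<and> B \<in> sets S}"

definition diff_op ::
    "'a measure \<Rightarrow> 'x measure \<Rightarrow> nat \<Rightarrow> (nat \<Rightarrow> 'a \<Rightarrow> 'x) \<Rightarrow> nat \<Rightarrow> ('a \<Rightarrow> real) \<Rightarrow> 'a \<Rightarrow> real" where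
  "diff_op M S n X k U =
     (\<lambda>\<omega>. U \<omega> - real_cond_exp M (sigma_gen M S X ({1..n} - {k})) U \<omega>)"

definition diff_op_alpha ::
    "'a measure \<Rightarrow> 'x measure \<Rightarrow> nat \<Rightarrow> (nat \<Rightarrow> 'a \<Rightarrow> 'x) \<Rightarrow> real \<Rightarrow> nat \<Rightarrow> ('a \<Rightarrow> real) \<Rightarrow> 'a \<Rightarrow> real" where
  "diff_op_alpha M S n X \<alpha> k U =
     (\<lambda>\<omega>. \<alpha> * real_cond_exp M (sigma_gen M S X {1..k}) (diff_op M S n X k U) \<omega> +
          (1 - \<alpha>) * real_cond_exp M (sigma_gen M S X {k..n}) (diff_op M S n X k U) \<omega>)"

definition Z_alpha ::
    "'a measure \<Rightarrow> 'x measure \<Rightarrow> nat \<Rightarrow> (nat \<Rightarrow> 'a \<Rightarrow> 'x) \<Rightarrow> real \<Rightarrow> ('a \<Rightarrow> real ^ 'd) \<Rightarrow>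
       'd \<Rightarrow> 'd \<Rightarrow> 'a \<Rightarrow> real" where
  "Z_alpha M S n X \<alpha> F i j =
     (\<lambda>\<omega>. \<Sum>k=1..n. diff_op M S n X k (\<lambda>\<omega>. F \<omega> $ i) \<omega> *
                     diff_op_alpha M S n X \<alpha> k (\<lambda>\<omega>. F \<omega> $ j) \<omega>)"


section \<open>Constants of the bound\<close>

definition B1 :: "real ^ 'd ^ 'd \<Rightarrow> (real ^ 'd \<Rightarrow> real) \<Rightarrow> ennreal" where
  "B1 C g = ennreal (opnorm (matrix_inv C) * sqrt (opnorm C)) * lip_const g"

definition B2 :: "real ^ 'd ^ 'd \<Rightarrow> (real ^ 'd \<Rightarrow> real) \<Rightarrow> ennreal" where
  "B2 C g = ennreal (sqrt (2 * pi) / 4 * opnorm (matrix_inv C) powr (3 / 2) * opnorm C) *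
            M2 g * of_nat (CARD('d) ^ 2)"

end

(* The proof interpolates along U(t) = sin t F + cos t Y, 0 <= t <= pi/2, with Y = A z independent
   of F, instead of solving Stein's equation. Put s = sin t, c = cos t. The derivative of E g(U(t))
   is c E<grad g(U), F> - s E<grad g(U), Y>. The second term equals s E<C, W(F)> where
   W(x) = E[grad g(s x + c Y) (C^-1 Y)^T]. For the first, F_j is the sum over k of
   D^(alpha)_k F_j, which is orthogonal to everything not depending on X_k; so
   m(x) = E grad g(s x + c Y) may be replaced by m(F) - m(E_k F), and a first-order expansion of m
   (whose derivative is (s/c) W) gives s E<Z^T, W(F)> plus a remainder controlled by M_2(g) and third
   moments. Cauchy-Schwarz bounds <B, W> by |C^-1|^(1/2) Lip(g) |B|, and the integral of sin t over
   [0, pi/2] is 1. The constants B_1, B_2 follow since |C| |C^-1| >= 1; B_2 has room to spare for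
   d >= 2. *)

theory Submission
  imports Defs
begin

section \<open>Integration lemmas\<close>

text \<open>Placing every derivative on the Gaussian density leaves only the gradient of g in W, so
  W is controlled by Lip(g), and M_2(g) enters as a modulus of continuity in the remainder. The
  price is a factor 1/c, singular at t = pi/2. It is harmless because the increment of m is
  multiplied by c, and the resulting bound is needed only for 0 < t < pi/2. The expansion is made at
  F, not at E_k F. Hence the same W(F) occurs for every k, the first-order terms add up to a pairing
  with Z^T, and C is subtracted from Z^T before any norm is taken. D^(alpha)_k F_j combines an
  increment of a forward martingale with one of a backward martingale. Therefore the sum over k
  telescopes for each alpha, and by Jensen its moments do not exceed those of D_k F_j. Third moments
  and variances may be infinite. The bounds on m and W keep the signed integrands integrable, while
  the majorants are integrated in [0, infinity].\<close>

text \<open>Differentiation under the integral is replaced by the fundamental theorem of calculus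
  for each fixed \<open>x\<close>, followed by Fubini; the uniform bound \<open>D\<close> supplies
  joint integrability. The bound \<open>h\<close> is required only on the open interval because the
  interpolation provides it only where cos t > 0.\<close>

lemma integral_increment_bound:
  fixes f f' :: "real \<Rightarrow> 'a \<Rightarrow> real" and h H :: "real \<Rightarrow> real"
  assumes sf: "sigma_finite_measure \<mu>" and ab: "a \<le> b"
    and deriv: "\<And>x t. x \<in> space \<mu> \<Longrightarrow> a \<le> t \<Longrightarrow> t \<le> b \<Longrightarrow>
                  ((\<lambda>t. f t x) has_real_derivative f' t x) (at t)"
    and cont: "\<And>x. x \<in> space \<mu> \<Longrightarrow> continuous_on {a..b} (\<lambda>t. f' t x)"
    and meas: "(\<lambda>(t, x). f' t x) \<in> borel_measurable (borel \<Otimes>\<^sub>M \<mu>)"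
    and fa: "integrable \<mu> (f a)" and fb: "integrable \<mu> (f b)"
    and int: "\<And>t. a \<le> t \<Longrightarrow> t \<le> b \<Longrightarrow> integrable \<mu> (f' t)"
    and D: "\<And>t. a \<le> t \<Longrightarrow> t \<le> b \<Longrightarrow> (\<integral>x. \<bar>f' t x\<bar> \<partial>\<mu>) \<le> D"
    and h: "\<And>t. a < t \<Longrightarrow> t < b \<Longrightarrow> \<bar>\<integral>x. f' t x \<partial>\<mu>\<bar> \<le> h t"
    and H: "\<And>t. (H has_real_derivative h t) (at t)" and hc: "continuous_on {a..b} h"
  shows "\<bar>(\<integral>x. f b x \<partial>\<mu>) - (\<integral>x. f a x \<partial>\<mu>)\<bar> \<le> H b - H a"
proof -
  define L where "L = restrict_space lborel {a..b}"
  interpret \<mu>: sigma_finite_measure \<mu> by fact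
  interpret L: finite_measure L
    unfolding L_def using ab by (intro finite_measureI) (simp add: emeasure_restrict_space space_restrict_space emeasure_lborel_Icc)
  interpret P: pair_sigma_finite L \<mu> ..
  have sp: "space L = {a..b}" by (simp add: L_def space_restrict_space)
  have id: "(\<lambda>x. x) \<in> measurable L borel"
    unfolding L_def by (rule measurable_restrict_space1) simp
  have m: "(\<lambda>(t, x). f' t x) \<in> borel_measurable (L \<Otimes>\<^sub>M \<mu>)"
  proof -
    have "(\<lambda>p. (fst p, snd p)) \<in> measurable (L \<Otimes>\<^sub>M \<mu>) (borel \<Otimes>\<^sub>M \<mu>)"
      by (intro measurable_Pair measurable_compose[OF measurable_fst id] measurable_snd)
    from measurable_compose[OF this meas] show ?thesis by (simp add: split_def)
  qed
  have I: "integrable (L \<Otimes>\<^sub>M \<mu>) (\<lambda>(t, x). f' t x)"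
  proof (rule P.Fubini_integrable[OF m])
    have "(\<lambda>t. \<integral>x. norm (f' t x) \<partial>\<mu>) \<in> borel_measurable L"
      using m by (intro \<mu>.borel_measurable_lebesgue_integral) (auto simp: split_def)
    then show "integrable L (\<lambda>t. \<integral>y. norm (case (t, y) of (t, x) \<Rightarrow> f' t x) \<partial>\<mu>)"
      using D by (intro L.integrable_const_bound[where B=D] AE_I2) (auto simp: sp)
    show "AE t in L. integrable \<mu> (\<lambda>y. case (t, y) of (t, x) \<Rightarrow> f' t x)"
      using int by (intro AE_I2) (auto simp: sp)
  qed
  have ftc: "(\<integral>t. f' t x \<partial>L) = f b x - f a x" if x: "x \<in> space \<mu>" for x
  proof -
    have "(\<integral>t. f' t x \<partial>L) = (\<integral>t. indicator {a..b} t *\<^sub>R f' t x \<partial>lborel)"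
      unfolding L_def by (subst integral_restrict_space) (auto simp: mult.commute)
    also have "\<dots> = f b x - f a x"
      using integral_FTC_Icc[OF ab, of "\<lambda>t. f t x" "\<lambda>t. f' t x"] deriv[OF x] cont[OF x] 
      by (simp add: has_real_derivative_iff_has_vector_derivative has_vector_derivative_at_within)
    finally show ?thesis .
  qed
  have ih: "integrable L h"
    unfolding L_def using borel_integrable_compact[OF _ hc]
    by (subst integrable_restrict_space) (auto simp: indicator_def)
  have ftch: "(\<integral>t. h t \<partial>L) = H b - H a"
  proof -
    have "(\<integral>t. h t \<partial>L) = (\<integral>t. indicator {a..b} t *\<^sub>R h t \<partial>lborel)"
      unfolding L_def by (subst integral_restrict_space) (auto simp: mult.commute)
    also have "\<dots> = H b - H a"
      using integral_FTC_Icc[OF ab, of H h] H hc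
      by (simp add: has_real_derivative_iff_has_vector_derivative has_vector_derivative_at_within)
    finally show ?thesis .
  qed
  have ends: "AE t in L. t \<noteq> a \<and> t \<noteq> b"
    unfolding L_def using AE_lborel_singleton[of a] AE_lborel_singleton[of b]
    by (subst AE_restrict_space_iff) (auto elim: eventually_elim2)
  have "(\<integral>x. f b x \<partial>\<mu>) - (\<integral>x. f a x \<partial>\<mu>) = (\<integral>x. (\<integral>t. f' t x \<partial>L) \<partial>\<mu>)"
    using fa fb by (subst Bochner_Integration.integral_cong[OF refl ftc]) auto
  also have "\<dots> = (\<integral>t. (\<integral>x. f' t x \<partial>\<mu>) \<partial>L)"
    by (rule P.Fubini_integral[OF I])
  also have "\<bar>\<dots>\<bar> \<le> (\<integral>t. \<bar>\<integral>x. f' t x \<partial>\<mu>\<bar> \<partial>L)" by (rule integral_abs_bound)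
  also have "\<dots> \<le> (\<integral>t. h t \<partial>L)"
  proof (rule integral_mono_AE[OF integrable_abs[OF P.integrable_fst[OF I]] ih])
    show "AE t in L. \<bar>\<integral>x. f' t x \<partial>\<mu>\<bar> \<le> h t"
      using ends by (rule AE_mp) (use h in \<open>auto simp: sp less_le intro!: AE_I2\<close>)
  qed
  finally show ?thesis by (simp add: ftch)
qed

section \<open>Vector-valued maps and square-integrable functions\<close>

lemma borel_measurable_vec_nth [measurable (raw)]:
  fixes f :: "'a \<Rightarrow> real^'d"
  assumes "f \<in> borel_measurable M"
  shows "(\<lambda>x. f x $ i) \<in> borel_measurable M"
proof -
  have "(\<lambda>x. f x \<bullet> axis i 1) \<in> borel_measurable M"
    using assms by (rule borel_measurable_inner) simp
  then show ?thesis by (simp add: inner_axis)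
qed

lemma borel_measurable_vecI:
  fixes f :: "'a \<Rightarrow> real^'d"
  assumes "\<And>i. (\<lambda>x. f x $ i) \<in> borel_measurable M"
  shows "f \<in> borel_measurable M"
  using assms by (subst borel_measurable_euclidean_space) (auto simp: Basis_vec_def inner_axis)

lemma norm_vec_integrable:
  fixes f :: "'a \<Rightarrow> real^'d"
  assumes "\<And>i. integrable M (\<lambda>x. f x $ i)"
  shows "integrable M (\<lambda>x. norm (f x))"
proof (rule Bochner_Integration.integrable_bound)
  show "integrable M (\<lambda>x. \<Sum>i\<in>UNIV. \<bar>f x $ i\<bar>)" using assms by auto
  have [measurable]: "f \<in> borel_measurable M"
    by (rule borel_measurable_vecI) (rule borel_measurable_integrable[OF assms])
  show "(\<lambda>x. norm (f x)) \<in> borel_measurable M" by measurable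
  show "AE x in M. norm (norm (f x)) \<le> norm (\<Sum>i\<in>UNIV. \<bar>f x $ i\<bar>)"
    by (auto simp: sum_nonneg intro!: AE_I2 norm_le_l1_cart)
qed

lemma integrable_mult_of_squares:
  fixes U V :: "'a \<Rightarrow> real"
  assumes [measurable]: "U \<in> borel_measurable M" "V \<in> borel_measurable M"
    and "integrable M (\<lambda>x. (U x)\<^sup>2)" "integrable M (\<lambda>x. (V x)\<^sup>2)"
  shows "integrable M (\<lambda>x. U x * V x)"
proof (rule Bochner_Integration.integrable_bound)
  show "integrable M (\<lambda>x. (U x)\<^sup>2 + (V x)\<^sup>2)" using assms by simp
  have "\<bar>u * v\<bar> \<le> u\<^sup>2 + v\<^sup>2" for u v :: real
  proof -
    have "2 * (\<bar>u\<bar> * \<bar>v\<bar>) \<le> u\<^sup>2 + v\<^sup>2"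
      using sum_squares_bound[of "\<bar>u\<bar>" "\<bar>v\<bar>"] by (simp add: mult.assoc)
    moreover have "0 \<le> \<bar>u\<bar> * \<bar>v\<bar>" by simp
    ultimately show ?thesis unfolding abs_mult by linarith
  qed
  then show "AE x in M. norm (U x * V x) \<le> norm ((U x)\<^sup>2 + (V x)\<^sup>2)"
    by (intro AE_I2) (auto intro: order_trans[OF _ abs_ge_self])
qed measurable

text \<open>The hypothesis has the shape of the p-th power contraction inequalities for conditional
  expectations, to be used at p = 2.\<close>

lemma square_integrable_nn_bound:
  fixes U V :: "'a \<Rightarrow> real"
  assumes "V \<in> borel_measurable M" and U: "integrable M (\<lambda>x. (U x)\<^sup>2)"
    and le: "(\<integral>\<^sup>+x. ennreal (\<bar>V x\<bar> ^ 2) \<partial>M) \<le> (\<integral>\<^sup>+x. ennreal (\<bar>U x\<bar> ^ 2) \<partial>M)"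
  shows "integrable M (\<lambda>x. (V x)\<^sup>2)"
proof (rule integrableI_bounded)
  have "(\<integral>\<^sup>+x. ennreal (norm ((U x)\<^sup>2)) \<partial>M) < \<infinity>" using U by (simp add: integrable_iff_bounded)
  then show "(\<integral>\<^sup>+x. ennreal (norm ((V x)\<^sup>2)) \<partial>M) < \<infinity>" using le by (auto intro: le_less_trans)
qed (use assms in measurable)

lemma (in prob_space) expectation_abs_le_sqrt:
  assumes "X \<in> borel_measurable M" and "integrable M (\<lambda>x. (X x)\<^sup>2)"
  shows "expectation (\<lambda>x. \<bar>X x\<bar>) \<le> sqrt (expectation (\<lambda>x. (X x)\<^sup>2))"
proof -
  have X: "integrable M X" using square_integrable_imp_integrable[OF assms] .
  have "0 \<le> variance (\<lambda>x. \<bar>X x\<bar>)" by simp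
  also have "\<dots> = expectation (\<lambda>x. (X x)\<^sup>2) - (expectation (\<lambda>x. \<bar>X x\<bar>))\<^sup>2"
    using X assms(2) by (subst variance_eq) auto
  finally show ?thesis by (intro real_le_rsqrt) simp
qed

section \<open>Square roots and second moments in [0, infinity]\<close>

lemma ennsqrt_ennreal: "0 \<le> r \<Longrightarrow> ennsqrt (ennreal r) = ennreal (sqrt r)"
  by (simp add: ennsqrt_def)

lemma ennsqrt_top: "ennsqrt \<top> = \<top>"
  by (simp add: ennsqrt_def)

lemma ennsqrt_add_le: "ennsqrt (x + y) \<le> ennsqrt x + ennsqrt y"
proof (cases x)
  case x: (real r)
  show ?thesis
  proof (cases y)
    case y: (real t)
    then show ?thesis using x
      by (simp add: ennsqrt_ennreal sqrt_add_le_add_sqrt ennreal_leI flip: ennreal_plus)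
  qed (simp add: ennsqrt_top)
qed (simp add: ennsqrt_top)

lemma ennsqrt_sum_le: "ennsqrt (\<Sum>i\<in>I. f i) \<le> (\<Sum>i\<in>I. ennsqrt (f i))"
proof (induction I rule: infinite_finite_induct)
  case (insert i I)
  then show ?case by (auto intro!: order_trans[OF ennsqrt_add_le] add_left_mono)
qed (simp_all add: ennsqrt_def)

lemma (in prob_space) nn_integral_le_ennsqrt:
  fixes h :: "'a \<Rightarrow> real"
  assumes [measurable]: "h \<in> borel_measurable M"
  shows "(\<integral>\<^sup>+x. ennreal \<bar>h x\<bar> \<partial>M) \<le> ennsqrt (\<integral>\<^sup>+x. ennreal ((h x)\<^sup>2) \<partial>M)"
proof (cases "(\<integral>\<^sup>+x. ennreal ((h x)\<^sup>2) \<partial>M) = \<top>")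
  case False
  then have I: "integrable M (\<lambda>x. (h x)\<^sup>2)"
    by (intro integrableI_bounded) (auto simp: less_top)
  have "integrable M h" by (rule square_integrable_imp_integrable[OF assms I])
  then have "(\<integral>\<^sup>+x. ennreal \<bar>h x\<bar> \<partial>M) = ennreal (\<integral>x. \<bar>h x\<bar> \<partial>M)"
    by (intro nn_integral_eq_integral) auto
  also have "\<dots> \<le> ennreal (sqrt (\<integral>x. (h x)\<^sup>2 \<partial>M))"
    by (intro ennreal_leI expectation_abs_le_sqrt I) simp
  also have "\<dots> = ennsqrt (\<integral>\<^sup>+x. ennreal ((h x)\<^sup>2) \<partial>M)"
    by (subst nn_integral_eq_integral[OF I]) (auto simp: ennsqrt_ennreal)
  finally show ?thesis .
qed (simp add: ennsqrt_top)

text \<open>Bias and variance: the cross term has mean zero, and the square root is subadditive. An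
  infinite variance makes the right side infinite.\<close>

lemma (in prob_space) ennsqrt_square_deviation_le:
  fixes U :: "'a \<Rightarrow> real"
  assumes U: "integrable M U"
  shows "ennsqrt (\<integral>\<^sup>+x. ennreal (\<bar>c - U x\<bar> ^ 2) \<partial>M)
           \<le> ennreal \<bar>c - expectation U\<bar> + ennsqrt (evariance M U)"
proof (cases "evariance M U = \<top>")
  case False
  let ?m = "expectation U"
  have [measurable]: "U \<in> borel_measurable M" using U by simp
  have I: "integrable M (\<lambda>x. (U x - ?m)\<^sup>2)"
    using False by (intro integrableI_bounded) (auto simp: less_top evariance_def)
  have eq: "\<bar>c - U x\<bar> ^ 2 = (c - ?m)\<^sup>2 - 2 * (c - ?m) * (U x - ?m) + (U x - ?m)\<^sup>2" for x
    by (simp add: power2_eq_square algebra_simps)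
  have I2: "integrable M (\<lambda>x. \<bar>c - U x\<bar> ^ 2)" unfolding eq using I U by simp
  have "(\<integral>x. \<bar>c - U x\<bar> ^ 2 \<partial>M) = (c - ?m)\<^sup>2 + variance U"
    unfolding eq using I U by (simp add: prob_space)
  then have nn: "(\<integral>\<^sup>+x. ennreal (\<bar>c - U x\<bar> ^ 2) \<partial>M) = ennreal ((c - ?m)\<^sup>2 + variance U)"
    by (subst nn_integral_eq_integral[OF I2]) simp_all
  have "ennsqrt (\<integral>\<^sup>+x. ennreal (\<bar>c - U x\<bar> ^ 2) \<partial>M) = ennreal (sqrt ((c - ?m)\<^sup>2 + variance U))"
    unfolding nn by (rule ennsqrt_ennreal) simp
  also have "\<dots> \<le> ennreal (\<bar>c - ?m\<bar> + sqrt (variance U))"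
    using sqrt_add_le_add_sqrt[of "(c - ?m)\<^sup>2" "variance U"] by (intro ennreal_leI) simp
  also have "\<dots> = ennreal \<bar>c - ?m\<bar> + ennsqrt (evariance M U)"
    unfolding evariance_def by (subst nn_integral_eq_integral[OF I]) (auto simp: ennsqrt_ennreal)
  finally show ?thesis .
qed (simp add: ennsqrt_top)

text \<open>The difference of the two sides is (a - b)^2 (a + 2 b) / 3. The weights add up to 1, so
  nothing is lost once both cubes have the same bound.\<close>

lemma Young_cubic: "(a::real) * b\<^sup>2 \<le> 1 / 3 * a ^ 3 + 2 / 3 * b ^ 3" if "0 \<le> a" "0 \<le> b"
proof -
  have "0 \<le> (a - b)\<^sup>2 * (a + 2 * b)" using that by simp
  also have "\<dots> = a ^ 3 - 3 * (a * b\<^sup>2) + 2 * b ^ 3"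
    by (simp add: power2_eq_square power3_eq_cube algebra_simps)
  finally show ?thesis by simp
qed

section \<open>The standard Gaussian measure\<close>

text \<open>\<open>lborel\<close> on a Euclidean space is the image of a product measure indexed by
  \<open>Basis\<close>. The bijection \<open>axis\<close> moves the product to the coordinate index,
  where the product formula applies.\<close>

lemma integral_prod_lborel_vec:
  fixes f :: "'d::finite \<Rightarrow> real \<Rightarrow> real"
  assumes f: "\<And>i. integrable lborel (f i)"
  shows "integrable lborel (\<lambda>z::real^'d. \<Prod>i\<in>UNIV. f i (z $ i))" (is ?int)
    and "(\<integral>z. (\<Prod>i\<in>UNIV. f i (z $ i)) \<partial>(lborel :: (real^'d) measure)) = (\<Prod>i\<in>UNIV. integral\<^sup>L lborel (f i))" (is ?eq)
proof -
  interpret P: product_sigma_finite "\<lambda>_::real^'d. lborel :: real measure" ..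
  define e :: "'d \<Rightarrow> real^'d" where "e i = axis i 1" for i
  define g where "g b = f (inv e b)" for b
  have e: "inj e" by (auto simp: inj_on_def e_def axis_eq_axis)
  have B: "(Basis :: (real^'d) set) = range e"
    by (auto simp: Basis_vec_def e_def)
  have [measurable]: "f i \<in> borel_measurable borel" for i 
    using borel_measurable_integrable[OF f, of i] by simp
  have coord: "(\<Sum>b\<in>Basis. w b *\<^sub>R b) $ i = w (e i)" for w :: "real^'d \<Rightarrow> real" and i
  proof -
    have "(\<Sum>b\<in>Basis. w b *\<^sub>R b) $ i = (\<Sum>j\<in>UNIV. w (e j) * e j $ i)"
      by (simp add: B sum.reindex[OF e] o_def)
    also have "\<dots> = (\<Sum>j\<in>UNIV. if j = i then w (e j) else 0)"
      by (intro sum.cong) (auto simp: e_def axis_def)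
    finally show ?thesis by simp
  qed
  have prod: "(\<Prod>i\<in>UNIV. f i (w (e i))) = (\<Prod>b\<in>Basis. g b (w b))" for w
    by (simp add: B prod.reindex[OF e] g_def e)
  have g: "integrable lborel (g b)" for b by (simp add: g_def f)
  have "integrable (\<Pi>\<^sub>M b\<in>Basis. lborel) (\<lambda>w. \<Prod>b\<in>Basis. g b (w b))"
    by (rule P.product_integrable_prod) (auto simp: g)
  then show ?int
    by (subst lborel_eq, subst integrable_distr_eq) (auto simp: coord prod simp del: sum_component)
  have "(\<integral>z. (\<Prod>i\<in>UNIV. f i (z $ i)) \<partial>(lborel :: (real^'d) measure)) 
    = (\<integral>w. (\<Prod>b\<in>Basis. g b (w b)) \<partial>(\<Pi>\<^sub>M b\<in>Basis. lborel))"
    by (subst lborel_eq, subst integral_distr) (auto simp: coord prod simp del: sum_component)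
  also have "\<dots> = (\<Prod>b\<in>Basis. integral\<^sup>L lborel (g b))"
    by (rule P.product_integral_prod) (auto simp: g)
  also have "\<dots> = (\<Prod>i\<in>UNIV. integral\<^sup>L lborel (f i))"
    by (simp add: B prod.reindex[OF e] g_def e)
  finally show ?eq .
qed

text \<open>The Gaussian density as a real function, so that it can be differentiated along a
  translation.\<close>

definition std_dens :: "real ^ 'd \<Rightarrow> real" where
  "std_dens z = (\<Prod>i\<in>UNIV. std_normal_density (z $ i))"

lemma std_dens_nonneg: "0 \<le> std_dens z"
  by (simp add: std_dens_def prod_nonneg)

lemma std_dens_eq: "std_dens (z :: real ^ 'd) = (1 / sqrt (2 * pi)) ^ CARD('d) * exp (- (z \<bullet> z) / 2)"
proof -
  have "(\<Prod>i\<in>UNIV. exp (- (z $ i)\<^sup>2 / 2)) = exp (- (z \<bullet> z) / 2)"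
    by (simp add: exp_sum[symmetric] inner_vec_def sum_negf[symmetric] sum_divide_distrib power2_eq_square)
  then show ?thesis
    by (simp only: std_dens_def std_normal_density_def prod.distrib prod_constant)
qed

lemma std_dens_measurable [measurable]: "std_dens \<in> borel_measurable borel"
  unfolding std_dens_def by measurable

lemma std_gaussian_eq: "std_gaussian = density lborel (\<lambda>z. ennreal (std_dens z))"
  by (simp add: std_gaussian_def std_dens_def)

lemma space_std_gaussian [simp]: "space std_gaussian = UNIV"
  and sets_std_gaussian [measurable_cong, simp]: "sets std_gaussian = sets borel"
  by (simp_all add: std_gaussian_eq)

lemma integrable_std_gaussian_iff:
  fixes h :: "real ^ 'd \<Rightarrow> real"
  assumes "h \<in> borel_measurable borel"
  shows "integrable std_gaussian h \<longleftrightarrow> integrable lborel (\<lambda>z. h z * std_dens z)"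
  using assms unfolding std_gaussian_eq
  by (subst integrable_density) (auto simp: std_dens_nonneg mult.commute)

lemma integral_std_gaussian:
  fixes h :: "real ^ 'd \<Rightarrow> real"
  assumes "h \<in> borel_measurable borel"
  shows "integral\<^sup>L std_gaussian h = (\<integral>z. h z * std_dens z \<partial>lborel)"
  using assms unfolding std_gaussian_eq
  by (subst integral_density) (auto simp: std_dens_nonneg mult.commute)

text \<open>The monomial is absorbed into the one-dimensional factors, each of which becomes a
  normal moment of order 0, 1 or 2. Order 1, with value 0, occurs exactly when
  \<open>i \<noteq> j\<close>.\<close>

lemma std_gaussian_moment2:
  "integrable std_gaussian (\<lambda>z::real^'d. z $ i * z $ j)" (is ?int)
  "(\<integral>z. z $ i * z $ j \<partial>(std_gaussian :: (real^'d) measure)) = (if i = j then 1 else 0)" (is ?eq)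
proof -
  define f where "f k x = std_normal_density x * ((if k = i then x else 1) * (if k = j then x else 1))" for k x
  have f: "integrable lborel (f k) \<and> integral\<^sup>L lborel (f k) = (if (k = i) = (k = j) then 1 else 0)" for k
    using integrable_std_normal_moment[of 0] integral_std_normal_moment_even[of 0]
      integrable_std_normal_moment[of 1] integral_std_normal_moment_odd[of 0]
      integrable_std_normal_moment[of 2] integral_std_normal_moment_even[of 1]
    by (auto simp: f_def[abs_def] power2_eq_square)
  have *: "(\<Prod>k\<in>UNIV. f k (z $ k)) = z $ i * z $ j * std_dens z" for z :: "real^'d"
    by (simp add: f_def prod.distrib std_dens_def prod.delta)
  show ?int
    using integral_prod_lborel_vec(1)[of f] f by (subst integrable_std_gaussian_iff) (auto simp: *)
  have "(\<integral>z. z $ i * z $ j \<partial>(std_gaussian :: (real^'d) measure)) = (\<Prod>k\<in>UNIV. (if (k = i) = (k = j) then 1 else 0))"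
    using integral_prod_lborel_vec(2)[of f] f by (subst integral_std_gaussian) (auto simp: *)
  also have "\<dots> = (if i = j then 1 else 0)" by (auto simp: prod_zero_iff)
  finally show ?eq .
qed

lemma std_dens_integral:
  "integrable lborel (std_dens :: real^'d \<Rightarrow> real)" "integral\<^sup>L lborel (std_dens :: real^'d \<Rightarrow> real) = 1"
  using integral_prod_lborel_vec[of "\<lambda>_::'d. std_normal_density"]
    integrable_std_normal_moment[of 0] integral_std_normal_moment_even[of 0]
  by (auto simp: std_dens_def[abs_def])

lemma prob_space_std_gaussian: "prob_space (std_gaussian :: (real^'d) measure)"
proof
  have "emeasure (std_gaussian :: (real^'d) measure) UNIV = (\<integral>\<^sup>+z. ennreal (std_dens z) \<partial>(lborel :: (real^'d) measure))"
    by (simp add: std_gaussian_eq emeasure_density)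
  also have "\<dots> = 1"
    using nn_integral_eq_integral[OF std_dens_integral(1)] by (simp add: std_dens_nonneg std_dens_integral)
  finally show "emeasure (std_gaussian :: (real^'d) measure) (space std_gaussian) = 1" by simp
qed

lemma std_gaussian_mean:
  "integrable std_gaussian (\<lambda>z::real^'d. z $ i)" (is ?int)
  "(\<integral>z. z $ i \<partial>(std_gaussian :: (real^'d) measure)) = 0" (is ?eq)
proof -
  define f where "f k x = std_normal_density x * (if k = i then x else 1)" for k x
  have f: "integrable lborel (f k) \<and> integral\<^sup>L lborel (f k) = (if k = i then 0 else 1)" for k
    using integrable_std_normal_moment[of 0] integral_std_normal_moment_even[of 0]
      integrable_std_normal_moment[of 1] integral_std_normal_moment_odd[of 0]
    by (auto simp: f_def[abs_def])
  have *: "(\<Prod>k\<in>UNIV. f k (z $ k)) = z $ i * std_dens z" for z :: "real^'d"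
    by (simp add: f_def prod.distrib std_dens_def prod.delta)
  show ?int
    using integral_prod_lborel_vec(1)[of f] f by (subst integrable_std_gaussian_iff) (auto simp: *)
  have "(\<integral>z. z $ i \<partial>(std_gaussian :: (real^'d) measure)) = (\<Prod>k\<in>UNIV. (if k = i then 0 else 1))"
    using integral_prod_lborel_vec(2)[of f] f by (subst integral_std_gaussian) (auto simp: *)
  also have "\<dots> = 0" by (auto simp: prod_zero_iff)
  finally show ?eq .
qed

lemma std_gaussian_inner:
  fixes v :: "real^'d"
  shows "integrable std_gaussian (\<lambda>z. (z \<bullet> v)\<^sup>2)" (is ?A)
    and "(\<integral>z. (z \<bullet> v)\<^sup>2 \<partial>std_gaussian) = (norm v)\<^sup>2" (is ?B)
    and "integrable std_gaussian (\<lambda>z. z \<bullet> v)" (is ?C)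
    and "(\<integral>z. \<bar>z \<bullet> v\<bar> \<partial>std_gaussian) \<le> norm v" (is ?D)
proof -
  interpret prob_space "std_gaussian :: (real^'d) measure" by (rule prob_space_std_gaussian)
  have *: "(z \<bullet> v)\<^sup>2 = (\<Sum>i\<in>UNIV. \<Sum>j\<in>UNIV. v $ i * v $ j * (z $ i * z $ j))" for z
    by (simp add: inner_vec_def power2_eq_square sum_product ac_simps)
  show A: ?A unfolding * using std_gaussian_moment2(1) by (intro Bochner_Integration.integrable_sum integrable_mult_right)
  have "(\<integral>z. (z \<bullet> v)\<^sup>2 \<partial>std_gaussian) = (\<Sum>i\<in>UNIV. \<Sum>j\<in>UNIV. v $ i * v $ j * (if i = j then 1 else 0))"
    unfolding * by (simp add: std_gaussian_moment2 integrable_mult_right Bochner_Integration.integral_sum)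
  also have "\<dots> = (norm v)\<^sup>2"
    unfolding power2_norm_eq_inner by (simp add: inner_vec_def if_distrib cong: if_cong)
  finally show B: ?B .
  have m: "(\<lambda>z. z \<bullet> v) \<in> borel_measurable std_gaussian" by measurable
  show ?C using square_integrable_imp_integrable[OF m A] .
  show ?D using expectation_abs_le_sqrt[OF m A] by (simp add: B)
qed

section \<open>Translations of the Gaussian density\<close>

lemma integral_lborel_shift:
  fixes h :: "real ^ 'd \<Rightarrow> real"
  assumes [measurable]: "h \<in> borel_measurable borel"
  shows "integrable lborel (\<lambda>z. h (z - c) :: real) \<longleftrightarrow> integrable lborel h"
    and "(\<integral>z. h (z - c) \<partial>lborel) = integral\<^sup>L lborel h"
proof -
  have "integrable (distr lborel borel ((+) c)) (\<lambda>z. h (z - c)) \<longleftrightarrow> integrable lborel h"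
    by (subst integrable_distr_eq) auto
  then show "integrable lborel (\<lambda>z. h (z - c)) \<longleftrightarrow> integrable lborel h" by (simp add: lborel_distr_plus)
  have "integral\<^sup>L (distr lborel borel ((+) c)) (\<lambda>z. h (z - c)) = integral\<^sup>L lborel h"
    by (subst integral_distr) auto
  then show "(\<integral>z. h (z - c) \<partial>lborel) = integral\<^sup>L lborel h" by (simp add: lborel_distr_plus)
qed

text \<open>The first argument of \<open>h\<close> is the translated point, the second the Gaussian
  point itself. Both are needed later: \<open>q\<close> is evaluated at the former and the factor
  \<open>z \<bullet> \<eta>\<close> at the latter.\<close>

lemma std_gaussian_shift:
  fixes h :: "real ^ 'd \<Rightarrow> real ^ 'd \<Rightarrow> real"
  assumes [measurable]: "(\<lambda>z. h (z + c) z) \<in> borel_measurable borel"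
  shows "integrable lborel (\<lambda>z. h z (z - c) * std_dens (z - c)) \<longleftrightarrow> integrable std_gaussian (\<lambda>z. h (z + c) z)"
    and "(\<integral>z. h z (z - c) * std_dens (z - c) \<partial>lborel) = (\<integral>z. h (z + c) z \<partial>std_gaussian)"
  using integral_lborel_shift[of "\<lambda>z. h (z + c) z * std_dens z" c]
  by (simp_all add: integrable_std_gaussian_iff integral_std_gaussian)

lemma std_dens_deriv:
  "((\<lambda>u. std_dens (z - u *\<^sub>R \<eta>)) has_real_derivative
     ((z - u *\<^sub>R \<eta>) \<bullet> \<eta>) * std_dens (z - u *\<^sub>R \<eta>)) (at u)"
proof -
  have "((\<lambda>u. (z - u *\<^sub>R \<eta>) \<bullet> (z - u *\<^sub>R \<eta>)) has_real_derivative - 2 * ((z - u *\<^sub>R \<eta>) \<bullet> \<eta>)) (at u)"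
    unfolding has_field_derivative_def
    by (auto intro!: derivative_eq_intros simp: inner_commute algebra_simps)
  then show ?thesis unfolding std_dens_eq
    by (auto intro!: derivative_eq_intros)
qed

lemma std_dens_continuous: "continuous_on A std_dens"
  unfolding std_dens_eq[abs_def] by (intro continuous_intros) auto

text \<open>Moving the translation onto the density turns the derivative along \<open>\<eta>\<close> into the factor
  \<open>z \<bullet> \<eta>\<close>, so \<open>q\<close> need not be differentiable.\<close>

lemma std_gaussian_translation_expansion:
  fixes q :: "real ^ 'd \<Rightarrow> real"
  assumes [measurable]: "q \<in> borel_measurable borel" and B: "\<And>z. \<bar>q z\<bar> \<le> B"
    and l: "\<And>z u. 0 \<le> u \<Longrightarrow> u \<le> 1 \<Longrightarrow> \<bar>q (z + u *\<^sub>R \<eta>) - q (z + \<eta>)\<bar> \<le> l"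
  shows "\<bar>(\<integral>z. q (z + \<eta>) \<partial>std_gaussian) - (\<integral>z. q z \<partial>std_gaussian)
           - (\<integral>z. q (z + \<eta>) * (z \<bullet> \<eta>) \<partial>std_gaussian)\<bar> \<le> l * norm \<eta>"
proof -
  interpret prob_space "std_gaussian :: (real^'d) measure" by (rule prob_space_std_gaussian)
  have l0: "0 \<le> l" using l[of 0 0] by linarith
  have B0: "0 \<le> B" using B[of 0] by linarith
  define \<kappa> where "\<kappa> = (\<integral>z. q (z + \<eta>) * (z \<bullet> \<eta>) \<partial>std_gaussian)"
  have I0: "integrable std_gaussian (\<lambda>z. q (z + c))" for c
    by (rule integrable_const_bound[where B=B]) (auto simp: B)
  have I1: "integrable std_gaussian (\<lambda>z. q (z + c) * (z \<bullet> \<eta>))" for c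
  proof (rule Bochner_Integration.integrable_bound)
    show "integrable std_gaussian (\<lambda>z. B * (z \<bullet> \<eta>))" by (intro integrable_mult_right std_gaussian_inner)
    show "AE z in std_gaussian. norm (q (z + c) * (z \<bullet> \<eta>)) \<le> norm (B * (z \<bullet> \<eta>))"
      using B B0 by (intro AE_I2) (auto simp: abs_mult intro!: mult_right_mono)
  qed measurable
  \<comment> \<open>The linear term makes the increment of \<open>?f\<close> over [0, 1] equal to
    the remainder of a first-order expansion whose slope is taken at u = 1. It carries
    \<open>std_dens z\<close> because a nonzero constant is not integrable for
    \<open>lborel\<close>.\<close>
  let ?f = "\<lambda>u z. q z * std_dens (z - u *\<^sub>R \<eta>) - u * (\<kappa> * std_dens z)"
  let ?f' = "\<lambda>u z. q z * (((z - u *\<^sub>R \<eta>) \<bullet> \<eta>) * std_dens (z - u *\<^sub>R \<eta>)) - \<kappa> * std_dens z"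
  have J0: "integrable lborel (\<lambda>z. q z * std_dens (z - c))" 
    "(\<integral>z. q z * std_dens (z - c) \<partial>lborel) = (\<integral>z. q (z + c) \<partial>std_gaussian)" for c
    using std_gaussian_shift[of "\<lambda>z _. q z" c] I0 by auto
  have J1: "integrable lborel (\<lambda>z. q z * (((z - c) \<bullet> \<eta>) * std_dens (z - c)))" 
    "(\<integral>z. q z * (((z - c) \<bullet> \<eta>) * std_dens (z - c)) \<partial>lborel) = (\<integral>z. q (z + c) * (z \<bullet> \<eta>) \<partial>std_gaussian)" for c
    using std_gaussian_shift[of "\<lambda>z w. q z * (w \<bullet> \<eta>)" c] I1 by (auto simp: mult.assoc)
  have "\<bar>integral\<^sup>L lborel (?f 1) - integral\<^sup>L lborel (?f 0)\<bar> \<le> l * norm \<eta> * 1 - l * norm \<eta> * 0"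
  proof (rule integral_increment_bound[where f'="?f'" and D="B * norm \<eta> + \<bar>\<kappa>\<bar>" and h="\<lambda>_. l * norm \<eta>"])
    show "sigma_finite_measure (lborel :: (real^'d) measure)" ..
    show "((\<lambda>u. ?f u z) has_real_derivative ?f' u z) (at u)" for z u
      by (auto intro!: derivative_eq_intros std_dens_deriv[THEN DERIV_cong])
    show "continuous_on {0..1} (\<lambda>u. ?f' u z)" for z
      by (intro continuous_intros continuous_on_compose2[OF std_dens_continuous[of UNIV]]) auto
    show "(\<lambda>(u, z). ?f' u z) \<in> borel_measurable (borel \<Otimes>\<^sub>M lborel)" by measurable
    show "integrable lborel (?f 0)" "integrable lborel (?f 1)" "integrable lborel (?f' u)" for u
      using J0(1)[of 0] J0(1)[of \<eta>] J1(1) std_dens_integral(1) by auto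
    show "(\<integral>z. \<bar>?f' u z\<bar> \<partial>lborel) \<le> B * norm \<eta> + \<bar>\<kappa>\<bar>" for u
    proof -
      have "(\<integral>z. \<bar>?f' u z\<bar> \<partial>lborel) \<le> (\<integral>z. \<bar>q z * (((z - u *\<^sub>R \<eta>) \<bullet> \<eta>) * std_dens (z - u *\<^sub>R \<eta>))\<bar> + \<bar>\<kappa>\<bar> * std_dens z \<partial>lborel)"
        using J1(1)[of "u *\<^sub>R \<eta>"] std_dens_integral(1)
        by (intro integral_mono integrable_abs Bochner_Integration.integrable_add Bochner_Integration.integrable_diff integrable_mult_right)
           (auto intro!: order_trans[OF abs_triangle_ineq4] simp: abs_mult std_dens_nonneg)
      also have "\<dots> = (\<integral>z. \<bar>q z * (((z - u *\<^sub>R \<eta>) \<bullet> \<eta>) * std_dens (z - u *\<^sub>R \<eta>))\<bar> \<partial>lborel) + \<bar>\<kappa>\<bar>"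
        using J1(1)[of "u *\<^sub>R \<eta>"] std_dens_integral
        by (subst Bochner_Integration.integral_add) auto
      also have "(\<integral>z. \<bar>q z * (((z - u *\<^sub>R \<eta>) \<bullet> \<eta>) * std_dens (z - u *\<^sub>R \<eta>))\<bar> \<partial>lborel)
          = (\<integral>z. \<bar>q (z + u *\<^sub>R \<eta>) * (z \<bullet> \<eta>)\<bar> \<partial>std_gaussian)"
        using std_gaussian_shift(2)[of "\<lambda>z w. \<bar>q z * (w \<bullet> \<eta>)\<bar>" "u *\<^sub>R \<eta>"]
        by (simp add: abs_mult std_dens_nonneg mult.assoc)
      also have "\<dots> \<le> (\<integral>z. B * \<bar>z \<bullet> \<eta>\<bar> \<partial>std_gaussian)"
        using I1[of "u *\<^sub>R \<eta>"] std_gaussian_inner(3)[of \<eta>] B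
        by (intro integral_mono integrable_abs integrable_mult_right) (auto simp: abs_mult intro!: mult_right_mono)
      also have "\<dots> \<le> B * norm \<eta>"
        using std_gaussian_inner(4)[of \<eta>] B0 by (simp add: mult_left_mono)
      finally show ?thesis by simp
    qed
    show "\<bar>integral\<^sup>L lborel (?f' u)\<bar> \<le> l * norm \<eta>" if "0 < u" "u < 1" for u
    proof -
      have "integral\<^sup>L lborel (?f' u) = (\<integral>z. q (z + u *\<^sub>R \<eta>) * (z \<bullet> \<eta>) \<partial>std_gaussian) - \<kappa>"
        by (subst Bochner_Integration.integral_diff) (auto simp: J1 I1 std_dens_integral)
      \<comment> \<open>Back under the Gaussian measure the error is a difference of
        \<open>q\<close> at two shifts, which the modulus \<open>l\<close> controls without any
        derivative of \<open>q\<close>.\<close>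
      also have "\<dots> = (\<integral>z. (q (z + u *\<^sub>R \<eta>) - q (z + \<eta>)) * (z \<bullet> \<eta>) \<partial>std_gaussian)"
        using I1[of "u *\<^sub>R \<eta>"] I1[of \<eta>] by (simp add: \<kappa>_def left_diff_distrib)
      also have "\<bar>\<dots>\<bar> \<le> (\<integral>z. \<bar>(q (z + u *\<^sub>R \<eta>) - q (z + \<eta>)) * (z \<bullet> \<eta>)\<bar> \<partial>std_gaussian)"
        by (rule integral_abs_bound)
      also have "\<dots> \<le> (\<integral>z. l * \<bar>z \<bullet> \<eta>\<bar> \<partial>std_gaussian)"
      proof (rule integral_mono)
        show "\<bar>(q (z + u *\<^sub>R \<eta>) - q (z + \<eta>)) * (z \<bullet> \<eta>)\<bar> \<le> l * \<bar>z \<bullet> \<eta>\<bar>" for z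
          unfolding abs_mult using l[of u z] that by (intro mult_right_mono) auto
      qed (use I1[of "u *\<^sub>R \<eta>"] I1[of \<eta>] std_gaussian_inner(3)[of \<eta>] in
            \<open>auto simp: left_diff_distrib\<close>)
      also have "\<dots> \<le> l * norm \<eta>"
        using std_gaussian_inner(4)[of \<eta>] l0 by (simp add: mult_left_mono)
      finally show ?thesis .
    qed
    show "((*) (l * norm \<eta>) has_real_derivative l * norm \<eta>) (at t)" for t
      by (auto intro!: derivative_eq_intros)
  qed auto
  moreover have "integral\<^sup>L lborel (?f 1) = (\<integral>z. q (z + \<eta>) \<partial>std_gaussian) - \<kappa>"
    by (simp, subst Bochner_Integration.integral_diff) (auto simp: J0 std_dens_integral)
  moreover have "integral\<^sup>L lborel (?f 0) = (\<integral>z. q z \<partial>std_gaussian)"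
    using J0[of 0] by simp
  ultimately show ?thesis by (simp add: \<kappa>_def algebra_simps)
qed

section \<open>Gradients, matrices and covariance\<close>

lemma lip_const_bound:
  fixes f :: "'a::real_normed_vector \<Rightarrow> 'b::real_normed_vector"
  assumes "lip_const f < \<top>"
  shows "norm (f x - f y) \<le> enn2real (lip_const f) * norm (x - y)"
proof (cases "x = y")
  case False
  have "ennreal (norm (f x - f y) / norm (x - y)) \<le> lip_const f"
    unfolding lip_const_def using False by (intro SUP_upper2[of "(x, y)"]) auto
  then have "norm (f x - f y) / norm (x - y) \<le> enn2real (lip_const f)"
    using enn2real_mono[OF _ assms] by fastforce
  then show ?thesis using False by (simp add: divide_le_eq)
qed simp

lemma gradient_derivative:
  assumes "g differentiable (at x)"
  shows "(g has_derivative (\<lambda>h. gradient g x \<bullet> h)) (at x)"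
proof -
  define D where "D = frechet_derivative g (at x)"
  have D: "(g has_derivative D) (at x)"
    using assms by (simp add: D_def frechet_derivative_works)
  interpret linear D using D by (rule has_derivative_linear)
  have "D h = gradient g x \<bullet> h" for h
  proof -
    have "h = (\<Sum>i\<in>UNIV. h $ i *\<^sub>R axis i 1)"
      by (simp add: basis_expansion scalar_mult_eq_scaleR[symmetric])
    then have "D h = D (\<Sum>i\<in>UNIV. h $ i *\<^sub>R axis i 1)" by simp
    also have "\<dots> = (\<Sum>i\<in>UNIV. h $ i * D (axis i 1))" by (simp add: sum scale)
    finally have "D h = (\<Sum>i\<in>UNIV. h $ i * D (axis i 1))" .
    then show ?thesis by (simp add: gradient_def D_def inner_vec_def mult.commute)
  qed
  then have "D = (\<lambda>h. gradient g x \<bullet> h)" by auto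
  with D show ?thesis by simp
qed

text \<open>The derivative in the direction of the gradient itself is its squared norm, and the
  difference quotients in that direction are at most L times its norm.\<close>

lemma norm_gradient_le:
  assumes "g differentiable (at x)" and L: "\<And>x y. \<bar>g x - g y\<bar> \<le> L * norm (x - y)"
  shows "norm (gradient g x) \<le> L"
proof -
  let ?G = "gradient g x"
  have "((\<lambda>t. g (x + t *\<^sub>R ?G)) has_real_derivative ?G \<bullet> ?G) (at 0)"
    unfolding has_field_derivative_def
    by (rule has_derivative_compose[of "\<lambda>t. x + t *\<^sub>R ?G" "\<lambda>t. t *\<^sub>R ?G" 0 UNIV g "\<lambda>h. ?G \<bullet> h", THEN has_derivative_eq_rhs])
       (auto intro!: derivative_eq_intros gradient_derivative assms(1) simp: fun_eq_iff)
  then have lim: "((\<lambda>t. (g (x + t *\<^sub>R ?G) - g x) / t) \<longlongrightarrow> ?G \<bullet> ?G) (at 0)"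
    by (simp add: has_field_derivative_iff)
  have "?G \<bullet> ?G \<le> L * norm ?G"
  proof (rule tendsto_upperbound[OF lim])
    have "(g (x + t *\<^sub>R ?G) - g x) / t \<le> L * norm ?G" if "t \<noteq> 0" for t
    proof -
      have "(g (x + t *\<^sub>R ?G) - g x) / t \<le> \<bar>g (x + t *\<^sub>R ?G) - g x\<bar> / \<bar>t\<bar>"
        by (metis abs_divide abs_ge_self)
      also have "\<dots> \<le> (L * (\<bar>t\<bar> * norm ?G)) / \<bar>t\<bar>"
        using L[of "x + t *\<^sub>R ?G" x] by (intro divide_right_mono) auto
      finally show ?thesis using that by simp
    qed
    then show "\<forall>\<^sub>F t in at 0. (g (x + t *\<^sub>R ?G) - g x) / t \<le> L * norm ?G"
      by (auto simp: eventually_at_filter)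
  qed simp
  moreover have "?G \<bullet> ?G = norm ?G * norm ?G" by (simp add: dot_square_norm power2_eq_square)
  moreover have "0 \<le> L" using L[of "axis undefined 1" 0] by (simp add: order_trans[OF abs_ge_zero])
  ultimately show ?thesis by (cases "norm ?G = 0") (auto simp: mult_le_cancel_right)
qed

section \<open>Operator norms and factorisation of the covariance\<close>

lemma norm_mat_vec_le: "norm (A *v x) \<le> opnorm A * norm x" for A :: "real^'d^'d"
  unfolding opnorm_def by (rule onorm) (rule matrix_vector_mul_bounded_linear)

lemma opnorm_nonneg: "0 \<le> opnorm A" for A :: "real^'d^'d"
  unfolding opnorm_def by (rule onorm_pos_le) (rule matrix_vector_mul_bounded_linear)

lemma positive_definite_invertible:
  fixes C :: "real^'d^'d"
  assumes "positive_definite C"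
  shows "invertible C"
  unfolding invertible_left_inverse matrix_left_invertible_ker
  using assms by (force simp: positive_definite_def)

lemma matrix_inv_inverse:
  fixes C :: "real^'d^'d"
  assumes "invertible C"
  shows "C ** matrix_inv C = mat 1" "matrix_inv C ** C = mat 1"
  using someI_ex[OF assms[unfolded invertible_def]] by (auto simp: matrix_inv_def)

text \<open>A unit vector is fixed by C^-1 C. This inequality is what allows the natural constants
  of the argument to be enlarged to \<open>B1\<close> and \<open>B2\<close>.\<close>

lemma opnorm_condition_number:
  fixes C :: "real^'d^'d"
  assumes "invertible C"
  shows "1 \<le> opnorm (matrix_inv C) * opnorm C"
proof -
  define x :: "real^'d" where "x = axis undefined 1"
  have "1 = norm (matrix_inv C *v (C *v x))"
    by (simp add: matrix_vector_mul_assoc matrix_inv_inverse assms x_def)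
  also have "\<dots> \<le> opnorm (matrix_inv C) * (opnorm C * norm x)"
    by (intro order_trans[OF norm_mat_vec_le] mult_left_mono norm_mat_vec_le opnorm_nonneg)
  finally show ?thesis by (simp add: x_def)
qed

text \<open>The first two moments depend only on the distribution: the mean forces the shift
  \<open>m\<close> to vanish, and the second moments of A z are the entries of A A^T. Invertibility
  of \<open>A\<close> is derived later from that of \<open>C\<close>.\<close>

lemma gaussian_covariance_factor:
  fixes C :: "real^'d^'d" and Y :: "'b \<Rightarrow> real^'d"
  assumes "gaussian_vector N Y" "centered N Y" "has_covariance_matrix N Y C"
  obtains A :: "real^'d^'d" where "C = A ** transpose A" "distr N borel Y = distr std_gaussian borel (\<lambda>z. A *v z)"
proof -
  interpret prob_space "std_gaussian :: (real^'d) measure" by (rule prob_space_std_gaussian)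
  obtain A :: "real^'d^'d" and m where Y[measurable]: "Y \<in> borel_measurable N"
    and D: "distr N borel Y = distr std_gaussian borel (\<lambda>z. A *v z + m)"
    using assms(1) unfolding gaussian_vector_def by blast
  have A[measurable]: "(\<lambda>z. A *v z) \<in> borel_measurable borel"
    by (intro borel_measurable_continuous_onI linear_continuous_on matrix_vector_mul_bounded_linear)
  have tr: "(\<integral>w. h (Y w) \<partial>N) = (\<integral>z. h (A *v z + m) \<partial>std_gaussian)"
    if [measurable]: "h \<in> borel_measurable borel" for h :: "real^'d \<Rightarrow> real"
  proof -
    have "(\<integral>w. h (Y w) \<partial>N) = (\<integral>y. h y \<partial>distr N borel Y)" by (subst integral_distr) auto
    also have "\<dots> = (\<integral>z. h (A *v z + m) \<partial>std_gaussian)" unfolding D by (subst integral_distr) auto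
    finally show ?thesis .
  qed
  have comp: "(A *v z) $ i = (\<Sum>k\<in>UNIV. A $ i $ k * z $ k)" for z i
    by (simp add: matrix_vector_mult_def)
  have mean: "(\<integral>z. (A *v z + m) $ i \<partial>std_gaussian) = m $ i" for i
    by (simp add: comp std_gaussian_mean Bochner_Integration.integral_add Bochner_Integration.integral_sum
        Bochner_Integration.integrable_sum prob_space[simplified])
  have m: "m = 0"
    using assms(2) tr[of "\<lambda>y. y $ _"] mean by (simp add: centered_def vec_eq_iff del: vector_add_component)
  have "C $ i $ j = (A ** transpose A) $ i $ j" for i j
  proof -
    have "C $ i $ j = (\<integral>w. Y w $ i * Y w $ j \<partial>N)"
      using assms(2,3) by (simp add: centered_def has_covariance_matrix_def)
    also have "\<dots> = (\<integral>z. (A *v z) $ i * (A *v z) $ j \<partial>std_gaussian)"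
      by (subst tr) (simp_all add: m)
    also have "\<dots> = (\<integral>z. (\<Sum>k\<in>UNIV. \<Sum>l\<in>UNIV. A $ i $ k * A $ j $ l * (z $ k * z $ l)) \<partial>std_gaussian)"
      by (simp add: comp sum_product ac_simps)
    also have "\<dots> = (\<Sum>k\<in>UNIV. \<Sum>l\<in>UNIV. A $ i $ k * A $ j $ l * (if k = l then 1 else 0))"
      by (simp add: std_gaussian_moment2 Bochner_Integration.integral_sum Bochner_Integration.integrable_sum)
    also have "\<dots> = (A ** transpose A) $ i $ j"
      by (simp add: matrix_matrix_mult_def transpose_def if_distrib cong: if_cong)
    finally show ?thesis .
  qed
  then have "C = A ** transpose A" by (simp add: vec_eq_iff)
  moreover have "distr N borel Y = distr std_gaussian borel (\<lambda>z. A *v z)" using D m by simp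
  ultimately show ?thesis by (rule that)
qed

text \<open>Since C^-1 = a^T a, the squared norm of a w is the inner product of w with C^-1 w. This
  is the origin of the square root of \<open>opnorm (matrix_inv C)\<close> in the constants.\<close>

lemma norm_inverse_factor_le:
  fixes A C a :: "real^'d^'d"
  assumes C: "C = A ** transpose A" "invertible C" and a: "A ** a = mat 1"
  shows "norm (a *v w) \<le> sqrt (opnorm (matrix_inv C)) * norm w"
proof -
  have aA: "a ** A = mat 1" using a by (simp add: matrix_left_right_inverse)
  have 1: "transpose a ** transpose A = mat 1"
    by (metis a matrix_transpose_mul transpose_mat)
  define x where "x = matrix_inv C *v w"
  have "w = A *v (transpose A *v x)"
    by (metis C(1) C(2) matrix_inv_inverse(1) matrix_vector_mul_assoc matrix_vector_mul_lid x_def)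
  then have "transpose a *v (a *v w) = transpose a *v (transpose A *v x)"
    by (simp add: matrix_vector_mul_assoc aA matrix_mul_assoc[symmetric])
  also have "\<dots> = x" by (simp add: matrix_vector_mul_assoc 1 del: transpose_matrix_vector)
  finally have x: "transpose a *v (a *v w) = x" .
  have "(norm (a *v w))\<^sup>2 = (a *v w) \<bullet> (a *v w)" by (simp add: power2_norm_eq_inner)
  also have "\<dots> = w \<bullet> x"
    by (metis x dot_lmul_matrix inner_commute transpose_matrix_vector)
  also have "\<dots> \<le> norm w * norm x" by (rule norm_cauchy_schwarz)
  also have "\<dots> \<le> norm w * (opnorm (matrix_inv C) * norm w)"
    unfolding x_def by (intro mult_left_mono norm_mat_vec_le) auto
  finally have "(norm (a *v w))\<^sup>2 \<le> (sqrt (opnorm (matrix_inv C)) * norm w)\<^sup>2"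
    by (simp add: power_mult_distrib opnorm_nonneg power2_eq_square ac_simps)
  then show ?thesis by (rule power2_le_imp_le) (simp add: opnorm_nonneg)
qed

text \<open>With k = |C^-1|^(1/2), both claims come from 1 <= k^2 |C|. The second also uses d sqrt
  (2 pi) / 4 >= 1, which follows from sqrt (2 pi) >= 2 and d >= 2.\<close>

lemma sqrt_opnorm_le:
  fixes C :: "real^'d^'d"
  assumes "invertible C"
  shows "sqrt (opnorm (matrix_inv C)) \<le> opnorm (matrix_inv C) * sqrt (opnorm C)"
    and "CARD('d) \<ge> 2 \<Longrightarrow> sqrt (opnorm (matrix_inv C)) * real CARD('d) \<le>
          sqrt (2 * pi) / 4 * opnorm (matrix_inv C) powr (3 / 2) * opnorm C * real (CARD('d) ^ 2)"
proof -
  define k where "k = sqrt (opnorm (matrix_inv C))"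
  have k: "0 \<le> k" "opnorm (matrix_inv C) = k * k" by (simp_all add: k_def opnorm_nonneg)
  have 1: "1 \<le> k * k * opnorm C" using opnorm_condition_number[OF assms] k by simp
  have kpos: "0 < k" using 1 k(1) by (cases "k = 0") auto
  have "1 \<le> k * sqrt (opnorm C)"
    using 1 k by (metis real_sqrt_ge_one real_sqrt_mult real_sqrt_mult_self abs_of_nonneg)
  then show "sqrt (opnorm (matrix_inv C)) \<le> opnorm (matrix_inv C) * sqrt (opnorm C)"
    using kpos by (simp flip: k_def add: k(2) mult.assoc)
  assume d: "CARD('d) \<ge> 2"
  have p: "opnorm (matrix_inv C) powr (3 / 2) = k * (k * k)"
  proof -
    have "opnorm (matrix_inv C) powr (3 / 2) = (k powr 2) powr (3 / 2)"
      using kpos by (simp add: k(2) powr_numeral power2_eq_square)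
    also have "\<dots> = k powr 3" by (simp add: powr_powr)
    also have "\<dots> = k * (k * k)" using kpos by (simp add: powr_numeral power3_eq_cube)
    finally show ?thesis .
  qed
  have "2 \<le> sqrt (2 * pi)" using pi_ge_two by (intro real_le_rsqrt) simp
  then have "1 \<le> sqrt (2 * pi) / 4 * real CARD('d)"
    using d mult_mono[of 2 "sqrt (2 * pi)" 2 "real CARD('d)"] by simp
  then have "1 * 1 \<le> (sqrt (2 * pi) / 4 * real CARD('d)) * (k * k * opnorm C)"
    using 1 by (intro mult_mono) auto
  then have "k * real CARD('d) * 1 \<le> k * real CARD('d) * ((sqrt (2 * pi) / 4 * real CARD('d)) * (k * k * opnorm C))"
    using k by (intro mult_left_mono) auto
  then show "sqrt (opnorm (matrix_inv C)) * real CARD('d) \<le>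
          sqrt (2 * pi) / 4 * opnorm (matrix_inv C) powr (3 / 2) * opnorm C * real (CARD('d) ^ 2)"
    unfolding p k_def[symmetric] by (simp add: power2_eq_square ac_simps)
qed

section \<open>Conditional expectations for independent variables\<close>

text \<open>The triangle inequality reduces the claim to x^p on the nonnegative half-line, where the
  power is monotone and convex for either parity of p.\<close>

lemma convex_on_abs_power: "convex_on UNIV (\<lambda>x::real. \<bar>x\<bar> ^ p)"
proof (rule convex_onI)
  have c: "convex_on {0::real..} (\<lambda>x. x ^ p)"
    using convex_power_odd[of p] convex_on_subset[OF convex_power_even[of p]] by (cases "even p") auto
  fix t x y :: real assume t: "0 < t" "t < 1"
  have "\<bar>(1 - t) *\<^sub>R x + t *\<^sub>R y\<bar> ^ p \<le> ((1 - t) * \<bar>x\<bar> + t * \<bar>y\<bar>) ^ p"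
    using t by (intro power_mono order_trans[OF abs_triangle_ineq]) (auto simp: abs_mult)
  also have "\<dots> \<le> (1 - t) * \<bar>x\<bar> ^ p + t * \<bar>y\<bar> ^ p"
    using convex_onD[OF c, of t "\<bar>x\<bar>" "\<bar>y\<bar>"] t by simp
  finally show "\<bar>(1 - t) *\<^sub>R x + t *\<^sub>R y\<bar> ^ p \<le> (1 - t) * \<bar>x\<bar> ^ p + t * \<bar>y\<bar> ^ p" .
qed simp

text \<open>Conditional Jensen for |x|^p. As an inequality in [0, infinity] it also covers variables
  with infinite p-th moment, where it is trivial.\<close>

lemma (in finite_measure_subalgebra) nn_integral_real_cond_exp_power_le:
  assumes U: "integrable M U"
  shows "(\<integral>\<^sup>+x. ennreal (\<bar>real_cond_exp M F U x\<bar> ^ p) \<partial>M) \<le> (\<integral>\<^sup>+x. ennreal (\<bar>U x\<bar> ^ p) \<partial>M)"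
proof (cases "(\<integral>\<^sup>+x. ennreal (\<bar>U x\<bar> ^ p) \<partial>M) = \<top>")
  case False
  have [measurable]: "U \<in> borel_measurable M" using U by simp
  have I: "integrable M (\<lambda>x. \<bar>U x\<bar> ^ p)"
    using False by (intro integrableI_bounded) (auto simp: less_top)
  have "AE x in M. \<bar>real_cond_exp M F U x\<bar> ^ p \<le> real_cond_exp M F (\<lambda>x. \<bar>U x\<bar> ^ p) x"
    using real_cond_exp_jensens_inequality(2)[where q="\<lambda>x. \<bar>x\<bar> ^ p" and X=U and I=UNIV] U I convex_on_abs_power
    by auto
  then have "(\<integral>\<^sup>+x. ennreal (\<bar>real_cond_exp M F U x\<bar> ^ p) \<partial>M) \<le>
      (\<integral>\<^sup>+x. ennreal (real_cond_exp M F (\<lambda>x. \<bar>U x\<bar> ^ p) x) \<partial>M)"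
    by (intro nn_integral_mono_AE) (auto elim!: eventually_mono intro: ennreal_leI)
  also have "\<dots> = ennreal (\<integral>x. real_cond_exp M F (\<lambda>x. \<bar>U x\<bar> ^ p) x \<partial>M)"
    using I by (intro nn_integral_eq_integral real_cond_exp_int real_cond_exp_pos) auto
  also have "\<dots> = ennreal (\<integral>x. \<bar>U x\<bar> ^ p \<partial>M)" using I by (simp add: real_cond_exp_int)
  also have "\<dots> = (\<integral>\<^sup>+x. ennreal (\<bar>U x\<bar> ^ p) \<partial>M)"
    using I by (intro nn_integral_eq_integral[symmetric]) auto
  finally show ?thesis .
qed simp

locale independent_family = prob_space M for M :: "'a measure" +
  fixes S :: "'x measure" and X :: "nat \<Rightarrow> 'a \<Rightarrow> 'x" and I :: "nat set"
  assumes indep: "indep_vars (\<lambda>_. S) X I"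
begin

abbreviation G :: "nat set \<Rightarrow> 'a measure" where "G \<equiv> sigma_gen M S X"

abbreviation E :: "nat set \<Rightarrow> ('a \<Rightarrow> real) \<Rightarrow> 'a \<Rightarrow> real" where
  "E K U \<equiv> real_cond_exp M (G K) U"

lemma X_measurable: "k \<in> I \<Longrightarrow> X k \<in> measurable M S"
  using indep by (auto simp: indep_vars_def)

lemma space_G [simp]: "space (G K) = space M"
  by (auto simp: sigma_gen_def intro!: space_measure_of)

lemma sets_G: "sets (G K) = sigma_sets (space M) {X k -` B \<inter> space M | k B. k \<in> K \<and> B \<in> sets S}"
  unfolding sigma_gen_def by (intro sets_measure_of) auto

lemma sets_G_mono: "K \<subseteq> L \<Longrightarrow> sets (G K) \<subseteq> sets (G L)"
  unfolding sets_G by (intro sigma_sets_mono') auto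

lemma subalgebra_G: "K \<subseteq> I \<Longrightarrow> subalgebra M (G K)"
  unfolding subalgebra_def sets_G
  by (auto intro!: sets.sigma_sets_subset measurable_sets[OF X_measurable])

lemma subalgebra_G_G: "K \<subseteq> L \<Longrightarrow> subalgebra (G L) (G K)"
  using sets_G_mono by (auto simp: subalgebra_def)

lemma finite_measure_subalgebra_G: "K \<subseteq> I \<Longrightarrow> finite_measure_subalgebra M (G K)"
  using subalgebra_G by unfold_locales auto

lemma X_measurable_G: "k \<in> K \<Longrightarrow> K \<subseteq> I \<Longrightarrow> X k \<in> measurable (G K) S"
  using X_measurable[of k] by (intro measurableI) (auto simp: sets_G dest: measurable_space)

lemma measurable_G_mono: "U \<in> borel_measurable (G K) \<Longrightarrow> K \<subseteq> L \<Longrightarrow> U \<in> borel_measurable (G L)"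
  by (rule measurable_from_subalg[OF subalgebra_G_G])

lemma measurable_G_M: "U \<in> borel_measurable (G K) \<Longrightarrow> K \<subseteq> I \<Longrightarrow> U \<in> borel_measurable M"
  by (rule measurable_from_subalg[OF subalgebra_G])

text \<open>The preimages under a single variable form a pi-system; independence survives grouping
  the indices into \<open>J\<close> and \<open>K\<close> and passing to the generated
  sigma-algebras.\<close>

lemma indep_set_G:
  assumes "J \<subseteq> I" "K \<subseteq> I" "J \<inter> K = {}"
  shows "indep_set (sets (G J)) (sets (G K))"
proof -
  let ?C = "\<lambda>i. {X i -` B \<inter> space M | B. B \<in> sets S}"
  let ?I = "\<lambda>b. if b then J else K"
  have "indep_sets ?C I" using indep by (auto simp: indep_vars_def2)
  then have "indep_sets ?C (\<Union>b\<in>UNIV. ?I b)"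
    by (rule indep_sets_mono_index[rotated]) (use assms in \<open>auto split: if_splits\<close>)
  then have "indep_sets (\<lambda>b. sigma_sets (space M) (\<Union>i\<in>?I b. ?C i)) UNIV"
  proof (rule indep_sets_collect_sigma)
    show "Int_stable (?C i)" for i
      by (auto simp: Int_stable_def) (metis (no_types) sets.Int vimage_Int Int_assoc Int_left_commute Int_absorb)
    show "disjoint_family_on ?I UNIV" using assms(3) by (auto simp: disjoint_family_on_def)
  qed
  moreover have "(\<Union>i\<in>L. ?C i) = {X k -` B \<inter> space M | k B. k \<in> L \<and> B \<in> sets S}" for L by auto
  then have "sigma_sets (space M) (\<Union>i\<in>?I b. ?C i) = case_bool (sets (G J)) (sets (G K)) b" for b
    by (simp add: sets_G split: bool.split)
  ultimately show ?thesis unfolding indep_set_def by simp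
qed

lemma indep_integral:
  assumes JK: "J \<subseteq> I" "K \<subseteq> I" "J \<inter> K = {}"
    and U: "integrable M U" "U \<in> borel_measurable (G J)" and A: "A \<in> sets (G K)"
  shows "(\<integral>x. U x * indicator A x \<partial>M) = (\<integral>x. U x \<partial>M) * prob A"
proof -
  have AM[measurable]: "A \<in> sets M" using A subalgebra_G[OF JK(2)] by (auto simp: subalgebra_def)
  have U'[measurable]: "U \<in> borel_measurable M" using U(1) by simp
  have ind: "indicator A \<in> borel_measurable (G K)" using A by simp
  have "indep_var borel U borel (indicator A :: 'a \<Rightarrow> real)"
    unfolding indep_var_eq
  proof (intro conjI)
    have 1: "sigma_sets (space M) {U -` B \<inter> space M | B. B \<in> sets borel} \<subseteq> sets (G J)"
      using measurable_sets[OF U(2)] sets.sigma_sets_subset[of "{U -` B \<inter> space M | B. B \<in> sets borel}" "G J"]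
      by auto
    have 2: "sigma_sets (space M) {(indicator A :: 'a \<Rightarrow> real) -` B \<inter> space M | B. B \<in> sets borel} \<subseteq> sets (G K)"
      using measurable_sets[OF ind]
        sets.sigma_sets_subset[of "{(indicator A :: 'a \<Rightarrow> real) -` B \<inter> space M | B. B \<in> sets borel}" "G K"]
      by auto
    show "indep_set (sigma_sets (space M) {U -` B \<inter> space M | B. B \<in> sets borel})
      (sigma_sets (space M) {(indicator A :: 'a \<Rightarrow> real) -` B \<inter> space M | B. B \<in> sets borel})"
      using indep_set_G[OF JK] 1 2 unfolding indep_sets2_eq by blast
  qed measurable
  then have "(\<integral>x. U x * indicator A x \<partial>M) = (\<integral>x. U x \<partial>M) * (\<integral>x. indicator A x \<partial>M)"
    by (rule indep_var_lebesgue_integral) (use U AM in \<open>auto simp: emeasure_eq_measure\<close>)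
  then show ?thesis by simp
qed

text \<open>Independence makes the averaging operators compose like intersections of index sets. The
  sets \<open>A1 \<inter> A2\<close>, with \<open>A1\<close> from \<open>G (J \<inter> K)\<close>
  and \<open>A2\<close> from \<open>G (K - J)\<close>, form a pi-system generating
  \<open>G K\<close>. On such a set the independence of \<open>A2\<close> from \<open>G J\<close>
  splits off the factor \<open>prob A2\<close>, and what remains is an integral over
  \<open>A1\<close>. A Dynkin argument extends the equality to \<open>G K\<close>.\<close>

lemma E_E_Int:
  assumes JK: "J \<subseteq> I" "K \<subseteq> I" and U: "integrable M U"
  shows "AE x in M. E K (E J U) x = E (J \<inter> K) U x"
proof -
  let ?L = "J \<inter> K"
  interpret J: finite_measure_subalgebra M "G J" by (rule finite_measure_subalgebra_G) fact
  interpret K: finite_measure_subalgebra M "G K" by (rule finite_measure_subalgebra_G) fact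
  interpret L: finite_measure_subalgebra M "G ?L" by (rule finite_measure_subalgebra_G) (use JK in auto)
  define V where "V = E J U"
  \<comment> \<open>Conditioning \<open>V\<close> instead of \<open>U\<close> makes the integrals of
    \<open>V\<close> and \<open>W\<close> over sets of \<open>G ?L\<close> agree directly; the tower
    property returns to \<open>U\<close> at the end.\<close>
  define W where "W = E ?L V"
  have V: "integrable M V" "V \<in> borel_measurable (G J)" unfolding V_def using U J.real_cond_exp_int(1) by auto
  have W: "integrable M W" "W \<in> borel_measurable (G ?L)" unfolding W_def using V L.real_cond_exp_int(1) by auto
  have KI: "K - J \<subseteq> I" using JK by auto
  have LI: "?L \<subseteq> I" using JK by auto
  define P where "P = {A \<inter> B | A B. A \<in> sets (G ?L) \<and> B \<in> sets (G (K - J))}"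
  have PK: "P \<subseteq> sets (G K)"
    using sets_G_mono[of ?L K] sets_G_mono[of "K - J" K] by (auto simp: P_def)
  have KM: "sets (G K) \<subseteq> sets M" using subalgebra_G[OF JK(2)] by (auto simp: subalgebra_def)
  have gen: "sets (G K) = sigma_sets (space M) P"
  proof
    show "sigma_sets (space M) P \<subseteq> sets (G K)" using PK sets.sigma_sets_subset[of P "G K"] by simp
    have "X k -` B \<inter> space M \<in> P" if "k \<in> K" "B \<in> sets S" for k B
    proof (cases "k \<in> J")
      case True
      then have "X k -` B \<inter> space M \<in> sets (G ?L)" using that by (auto simp: sets_G)
      moreover have "space M \<in> sets (G (K - J))" using sets.top[of "G (K - J)"] by simp
      moreover have "X k -` B \<inter> space M = (X k -` B \<inter> space M) \<inter> space M" by auto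
      ultimately show ?thesis unfolding P_def by blast
    next
      case False
      then have "X k -` B \<inter> space M \<in> sets (G (K - J))" using that by (auto simp: sets_G)
      moreover have "space M \<in> sets (G ?L)" using sets.top[of "G ?L"] by simp
      moreover have "X k -` B \<inter> space M = space M \<inter> (X k -` B \<inter> space M)" by auto
      ultimately show ?thesis unfolding P_def by blast
    qed
    then show "sets (G K) \<subseteq> sigma_sets (space M) P"
      unfolding sets_G[of K] by (intro sigma_sets_mono') auto
  qed
  have base: "(LINT x:A|M. V x) = (LINT x:A|M. W x)" if AP: "A \<in> P" for A
  proof -
    obtain A1 A2 where A: "A = A1 \<inter> A2" and A1: "A1 \<in> sets (G ?L)" and A2: "A2 \<in> sets (G (K - J))"
      using AP unfolding P_def by blast
    have A1J: "A1 \<in> sets (G J)" using A1 sets_G_mono[of ?L J] by auto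
    have A1M: "A1 \<in> sets M" using A1 subalgebra_G[OF LI] by (auto simp: subalgebra_def)
    have *: "(LINT x:A|M. T x) = (\<integral>x. T x * indicator A1 x \<partial>M) * prob A2"
      if T: "integrable M T" "T \<in> borel_measurable (G J)" for T
    proof -
      have "(LINT x:A|M. T x) = (\<integral>x. (T x * indicator A1 x) * indicator A2 x \<partial>M)"
        by (auto simp: set_lebesgue_integral_def A indicator_inter_arith intro!: Bochner_Integration.integral_cong)
      also have "\<dots> = (\<integral>x. T x * indicator A1 x \<partial>M) * prob A2"
        using T A1J A1M A2 by (intro indep_integral[OF JK(1) KI]) (auto intro!: integrable_real_mult_indicator)
      finally show ?thesis .
    qed
    have "(\<integral>x. V x * indicator A1 x \<partial>M) = (\<integral>x. W x * indicator A1 x \<partial>M)"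
      using L.real_cond_exp_intA[OF V(1) A1] by (simp add: set_lebesgue_integral_def W_def mult.commute)
    then show ?thesis
      using *[OF V] *[OF W(1) measurable_G_mono[OF W(2)]] by simp
  qed
  have IS: "Int_stable P"
  proof (rule Int_stableI)
    fix a b assume "a \<in> P" "b \<in> P"
    then obtain A B A' B' where "a = A \<inter> B" "b = A' \<inter> B'" "A \<in> sets (G ?L)" "A' \<in> sets (G ?L)"
      "B \<in> sets (G (K - J))" "B' \<in> sets (G (K - J))" by (auto simp: P_def)
    moreover have "(A \<inter> B) \<inter> (A' \<inter> B') = (A \<inter> A') \<inter> (B \<inter> B')" by auto
    ultimately show "a \<inter> b \<in> P" unfolding P_def by blast
  qed
  have PP: "P \<subseteq> Pow (space M)" using PK KM sets.sets_into_space[of _ M] by blast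
  have si: "set_integrable M A T" if "A \<in> sets M" "integrable M T" for A and T :: "'a \<Rightarrow> real"
    using that unfolding set_integrable_def by (intro integrable_mult_indicator)
  have VW: "(\<integral>x. V x \<partial>M) = (\<integral>x. W x \<partial>M)" unfolding W_def using L.real_cond_exp_int(2)[OF V(1)] by simp
  have main: "(LINT x:A|M. V x) = (LINT x:A|M. W x)" if "A \<in> sigma_sets (space M) P" for A
    using IS PP that
  proof (induction rule: sigma_sets_induct_disjoint)
    case (basic A) then show ?case by (rule base)
  next
    case empty show ?case by (simp add: set_lebesgue_integral_def)
  next
    case (compl A)
    have AM: "A \<in> sets M" using compl gen KM by auto
    have "(LINT x:space M - A|M. T x) = (\<integral>x. T x \<partial>M) - (LINT x:A|M. T x)" if T: "integrable M T" for T :: "'a \<Rightarrow> real"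
    proof -
      have "(LINT x:(space M - A) \<union> A|M. T x) = (LINT x:space M - A|M. T x) + (LINT x:A|M. T x)"
        using AM T by (intro set_integral_Un si) auto
      moreover have "(space M - A) \<union> A = space M" using sets.sets_into_space[OF AM] by auto
      ultimately show ?thesis by (simp add: set_integral_space[OF T])
    qed
    then show ?case using V(1) W(1) VW compl by simp
  next
    case (union A)
    have AM: "range A \<subseteq> sets M" using union gen KM by auto
    have "(LINT x:(\<Union>i. A i)|M. T x) = (\<Sum>i. (LINT x:(A i)|M. T x))" if T: "integrable M T" for T :: "'a \<Rightarrow> real"
      using AM union(1) T by (intro lebesgue_integral_countable_add si) (auto simp: disjoint_family_on_def)
    then show ?case using V(1) W(1) union by simp
  qed
  have "AE x in M. E K V x = W x"
    by (rule K.real_cond_exp_charact) (use main gen V W measurable_G_mono[OF W(2)] in auto)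
  moreover have "AE x in M. W x = E ?L U x"
    unfolding W_def V_def using L.real_cond_exp_nested_subalg[OF subalgebra_G[OF JK(1)] subalgebra_G_G U] by simp
  ultimately show ?thesis unfolding V_def by auto
qed

lemma E_empty:
  assumes "integrable M U"
  shows "AE x in M. E {} U x = expectation U"
proof -
  interpret finite_measure_subalgebra M "G {}" by (rule finite_measure_subalgebra_G) simp
  show ?thesis
  proof (rule real_cond_exp_charact)
    fix A assume "A \<in> sets (G {})"
    then have "A = {} \<or> A = space M" by (simp add: sets_G sigma_sets_empty_eq)
    then show "(LINT x:A|M. U x) = (LINT x:A|M. expectation U)"
    proof
      assume "A = space M"
      moreover have "(LINT x:space M|M. U x) = expectation U"
        by (rule set_integral_space) fact
      moreover have "(LINT x:space M|M. expectation U) = expectation U"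
        by (subst set_integral_space) (auto simp: prob_space)
      ultimately show ?thesis by simp
    qed (simp add: set_lebesgue_integral_def)
  qed (use assms in auto)
qed

end

section \<open>Difference operators as martingale increments\<close>

locale finite_independent_family = independent_family M S X "{1..n}" for M S X n
begin

abbreviation D :: "nat \<Rightarrow> ('a \<Rightarrow> real) \<Rightarrow> 'a \<Rightarrow> real" where "D k U \<equiv> diff_op M S n X k U"

abbreviation DA :: "real \<Rightarrow> nat \<Rightarrow> ('a \<Rightarrow> real) \<Rightarrow> 'a \<Rightarrow> real" where
  "DA \<alpha> k U \<equiv> diff_op_alpha M S n X \<alpha> k U"

lemma subalg_sigma_finite: "K \<subseteq> {1..n} \<Longrightarrow> sigma_finite_subalgebra M (G K)"
  by (intro finite_measure_subalgebra_is_sigma_finite finite_measure_subalgebra_G)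

lemma integrable_E: "K \<subseteq> {1..n} \<Longrightarrow> integrable M U \<Longrightarrow> integrable M (E K U)"
  by (intro sigma_finite_subalgebra.real_cond_exp_int(1) subalg_sigma_finite)

lemma integrable_D: "integrable M U \<Longrightarrow> integrable M (D k U)"
  unfolding diff_op_def by (intro Bochner_Integration.integrable_diff integrable_E) auto

lemma integrable_DA:
  assumes "integrable M U" "k \<in> {1..n}"
  shows "integrable M (DA \<alpha> k U)"
  unfolding diff_op_alpha_def using assms
  by (intro Bochner_Integration.integrable_add integrable_mult_right integrable_E integrable_D) auto

text \<open>By \<open>E_E_Int\<close>, conditioning on \<open>K\<close> after averaging out
  \<open>X k\<close> leaves \<open>K - {k}\<close>. The choices \<open>{1..k}\<close> and
  \<open>{k..n}\<close> give the increments of the forward and the backward martingale of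
  \<open>U\<close>.\<close>

lemma E_D:
  assumes U: "integrable M U" and K: "K \<subseteq> {1..n}"
  shows "AE x in M. E K (D k U) x = E K U x - E (K - {k}) U x"
proof -
  interpret K: sigma_finite_subalgebra M "G K" by (rule subalg_sigma_finite) fact
  have "AE x in M. E K (D k U) x = E K U x - E K (E ({1..n} - {k}) U) x"
    unfolding diff_op_def using U by (intro K.real_cond_exp_diff integrable_E) auto
  moreover have eq: "({1..n} - {k}) \<inter> K = K - {k}" using K by blast
  have "AE x in M. E K (E ({1..n} - {k}) U) x = E (K - {k}) U x"
    unfolding eq[symmetric] by (rule E_E_Int) (use K U in auto)
  ultimately show ?thesis by eventually_elim simp
qed

lemma DA_eq:
  assumes U: "integrable M U" and k: "k \<in> {1..n}"
  shows "AE x in M. DA \<alpha> k U x = \<alpha> * (E {1..k} U x - E {1..k - 1} U x)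
                                + (1 - \<alpha>) * (E {k..n} U x - E {Suc k..n} U x)"
proof -
  have eq: "{1..k} - {k} = {1..k - 1}" "{k..n} - {k} = {Suc k..n}" using k by auto
  have "AE x in M. E {1..k} (D k U) x = E {1..k} U x - E {1..k - 1} U x"
    "AE x in M. E {k..n} (D k U) x = E {k..n} U x - E {Suc k..n} U x"
    using E_D[OF U, of "{1..k}" k] E_D[OF U, of "{k..n}" k] k by (simp_all only: eq) simp_all
  then show ?thesis by eventually_elim (simp add: diff_op_alpha_def)
qed

text \<open>Both telescoping sums equal U - E[U], hence so does their combination with weights
  \<alpha> and 1 - \<alpha>. Measurability in \<open>G {1..n}\<close> identifies the last term of
  each martingale with \<open>U\<close>.\<close>

lemma sum_DA:
  assumes U: "integrable M U" "U \<in> borel_measurable (G {1..n})"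
  shows "AE x in M. (\<Sum>k=1..n. DA \<alpha> k U x) = U x - expectation U"
proof -
  interpret T: sigma_finite_subalgebra M "G {1..n}" by (rule subalg_sigma_finite) simp
  have "AE x in M. \<forall>k\<in>{1..n}. DA \<alpha> k U x = \<alpha> * (E {1..k} U x - E {1..k - 1} U x)
                                + (1 - \<alpha>) * (E {k..n} U x - E {Suc k..n} U x)"
    by (rule AE_finite_allI[OF _ DA_eq[OF U(1)]]) auto
  then show ?thesis
    using T.real_cond_exp_F_meas[OF U] E_empty[OF U(1)]
  proof eventually_elim
    case (elim x)
    have "(\<Sum>k=1..n. DA \<alpha> k U x) = \<alpha> * (\<Sum>k=1..n. E {1..k} U x - E {1..k - 1} U x)
         + (1 - \<alpha>) * (\<Sum>k=1..n. E {k..n} U x - E {Suc k..n} U x)"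
      using elim(1) by (simp add: sum.distrib sum_distrib_left)
    also have "(\<Sum>k=1..n. E {1..k} U x - E {1..k - 1} U x) = E {1..n} U x - E {1..0} U x"
      using sum_telescope''[of 0 n "\<lambda>k. E {1..k} U x"] by (simp add: atLeastSucAtMost_greaterThanAtMost)
    also have "(\<Sum>k=1..n. E {k..n} U x - E {Suc k..n} U x) = E {1..n} U x - E {Suc n..n} U x"
      using sum_Suc_diff[of 1 n "\<lambda>k. - E {k..n} U x"] by simp
    \<comment> \<open>The index sets \<open>{1..0}\<close> and \<open>{Suc n..n}\<close> are empty,
      so both lower ends are the plain expectation.\<close>
    finally show ?case using elim(2,3) by (simp add: algebra_simps)
  qed
qed

text \<open>Averaging out \<open>X k\<close> turns each half into a conditional expectation of
  \<open>D k U\<close> given some of the other variables, and there the two terms of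
  \<open>E_D\<close> coincide.\<close>

lemma E_DA_zero:
  assumes U: "integrable M U" and k: "k \<in> {1..n}"
  shows "AE x in M. E ({1..n} - {k}) (DA \<alpha> k U) x = 0"
proof -
  let ?J = "{1..n} - {k}"
  interpret J: sigma_finite_subalgebra M "G ?J" by (rule subalg_sigma_finite) auto
  have z: "AE x in M. E ?J (E K (D k U)) x = 0" if K: "K \<subseteq> {1..n}" for K
  proof -
    have "AE x in M. E ?J (E K (D k U)) x = E (K \<inter> ?J) (D k U) x"
      by (rule E_E_Int) (use K U integrable_D in auto)
    moreover have "AE x in M. E (K \<inter> ?J) (D k U) x = 0"
    proof -
      have eq: "K \<inter> ?J - {k} = K \<inter> ?J" by blast
      show ?thesis using E_D[OF U, of "K \<inter> ?J" k] unfolding eq by auto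
    qed
    ultimately show ?thesis by eventually_elim simp
  qed
  have I: "integrable M (E K (D k U))" if "K \<subseteq> {1..n}" for K using that U by (intro integrable_E integrable_D)
  have k': "{1..k} \<subseteq> {1..n}" "{k..n} \<subseteq> {1..n}" using k by auto
  have "AE x in M. E ?J (DA \<alpha> k U) x = E ?J (\<lambda>x. \<alpha> * E {1..k} (D k U) x) x + E ?J (\<lambda>x. (1 - \<alpha>) * E {k..n} (D k U) x) x"
    unfolding diff_op_alpha_def using I k' by (intro J.real_cond_exp_add) auto
  then show ?thesis
    using z[OF k'(1)] z[OF k'(2)] J.real_cond_exp_cmult[OF I[OF k'(1)], of \<alpha>]
      J.real_cond_exp_cmult[OF I[OF k'(2)], of "1 - \<alpha>"]
    by eventually_elim simp
qed

lemma integral_mult_DA_zero: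
  assumes U: "integrable M U" and k: "k \<in> {1..n}"
    and V: "V \<in> borel_measurable (G ({1..n} - {k}))" and VU: "integrable M (\<lambda>x. V x * DA \<alpha> k U x)"
  shows "(\<integral>x. V x * DA \<alpha> k U x \<partial>M) = 0"
proof -
  let ?J = "{1..n} - {k}"
  interpret J: sigma_finite_subalgebra M "G ?J" by (rule subalg_sigma_finite) auto
  have "(\<integral>x. V x * DA \<alpha> k U x \<partial>M) = (\<integral>x. V x * E ?J (DA \<alpha> k U) x \<partial>M)"
    using integrable_DA[OF U k] by (intro J.real_cond_exp_intg(2)[symmetric] VU V) auto
  also have "\<dots> = (\<integral>x. 0 \<partial>M)"
    using E_DA_zero[OF U k, of \<alpha>] V measurable_G_M
    by (intro integral_cong_AE) (auto elim!: eventually_mono intro!: borel_measurable_times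
         measurable_G_M[OF V] measurable_G_M[OF borel_measurable_cond_exp])
  finally show ?thesis by simp
qed

text \<open>Jensen is used twice, for the weights \<alpha> and 1 - \<alpha> and for the two
  conditional expectations. The case p = 2 serves integrability, p = 3 the remainder.\<close>

lemma nn_integral_DA_power_le:
  assumes U: "integrable M U" and k: "k \<in> {1..n}" and \<alpha>: "0 \<le> \<alpha>" "\<alpha> \<le> 1"
  shows "(\<integral>\<^sup>+x. ennreal (\<bar>DA \<alpha> k U x\<bar> ^ p) \<partial>M) \<le> (\<integral>\<^sup>+x. ennreal (\<bar>D k U x\<bar> ^ p) \<partial>M)" (is "_ \<le> ?R")
proof -
  let ?a = "\<lambda>x. E {1..k} (D k U) x" and ?b = "\<lambda>x. E {k..n} (D k U) x"
  have k': "{1..k} \<subseteq> {1..n}" "{k..n} \<subseteq> {1..n}" using k by auto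
  have J: "(\<integral>\<^sup>+x. ennreal (\<bar>E K (D k U) x\<bar> ^ p) \<partial>M) \<le> ?R" if "K \<subseteq> {1..n}" for K
    by (rule finite_measure_subalgebra.nn_integral_real_cond_exp_power_le[OF finite_measure_subalgebra_G[OF that]])
       (rule integrable_D[OF U])
  have [measurable]: "?a \<in> borel_measurable M" "?b \<in> borel_measurable M"
    using integrable_E[OF k'(1) integrable_D[OF U]] integrable_E[OF k'(2) integrable_D[OF U]] by auto
  have "\<bar>DA \<alpha> k U x\<bar> ^ p \<le> \<alpha> * \<bar>?a x\<bar> ^ p + (1 - \<alpha>) * \<bar>?b x\<bar> ^ p" for x
    using convex_onD[OF convex_on_abs_power, of "1 - \<alpha>" "?a x" "?b x" p] \<alpha> by (simp add: diff_op_alpha_def)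
  then have "(\<integral>\<^sup>+x. ennreal (\<bar>DA \<alpha> k U x\<bar> ^ p) \<partial>M) \<le>
     (\<integral>\<^sup>+x. ennreal \<alpha> * ennreal (\<bar>?a x\<bar> ^ p) + ennreal (1 - \<alpha>) * ennreal (\<bar>?b x\<bar> ^ p) \<partial>M)"
    using \<alpha> by (intro nn_integral_mono) (auto simp flip: ennreal_mult ennreal_plus intro!: ennreal_leI)
  also have "\<dots> = ennreal \<alpha> * (\<integral>\<^sup>+x. ennreal (\<bar>?a x\<bar> ^ p) \<partial>M) + ennreal (1 - \<alpha>) * (\<integral>\<^sup>+x. ennreal (\<bar>?b x\<bar> ^ p) \<partial>M)"
    by (simp add: nn_integral_add nn_integral_cmult)
  also have "\<dots> \<le> ennreal \<alpha> * ?R + ennreal (1 - \<alpha>) * ?R"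
    by (intro add_mono mult_left_mono J k') auto
  also have "\<dots> = ?R" using \<alpha> by (simp flip: distrib_right ennreal_plus)
  finally show ?thesis .
qed

lemma square_integrable_D:
  assumes U: "U \<in> borel_measurable M" "integrable M (\<lambda>x. (U x)\<^sup>2)"
  shows "integrable M (\<lambda>x. (E ({1..n} - {k}) U x)\<^sup>2)" (is ?A)
    and "integrable M (\<lambda>x. (D k U x)\<^sup>2)" (is ?B)
proof -
  have I: "integrable M U" by (rule square_integrable_imp_integrable[OF U])
  show A: ?A
  proof (rule square_integrable_nn_bound[OF _ U(2)])
    show "E ({1..n} - {k}) U \<in> borel_measurable M" using integrable_E[OF _ I, of "{1..n} - {k}"] by auto
    show "(\<integral>\<^sup>+x. ennreal (\<bar>E ({1..n} - {k}) U x\<bar> ^ 2) \<partial>M) \<le> (\<integral>\<^sup>+x. ennreal (\<bar>U x\<bar> ^ 2) \<partial>M)"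
      by (rule finite_measure_subalgebra.nn_integral_real_cond_exp_power_le[OF finite_measure_subalgebra_G I]) auto
  qed
  have "integrable M (\<lambda>x. U x * E ({1..n} - {k}) U x)"
    using integrable_E[OF _ I, of "{1..n} - {k}"] by (intro integrable_mult_of_squares U A) auto
  then show ?B unfolding diff_op_def power2_diff
    using U(2) A by (intro Bochner_Integration.integrable_diff Bochner_Integration.integrable_add) (auto simp: mult.assoc)
qed

lemma square_integrable_DA:
  assumes U: "U \<in> borel_measurable M" "integrable M (\<lambda>x. (U x)\<^sup>2)" and "k \<in> {1..n}" "0 \<le> \<alpha>" "\<alpha> \<le> 1"
  shows "integrable M (\<lambda>x. (DA \<alpha> k U x)\<^sup>2)"
proof (rule square_integrable_nn_bound[OF _ square_integrable_D(2)[OF U]])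
  have I: "integrable M U" by (rule square_integrable_imp_integrable[OF U])
  show "DA \<alpha> k U \<in> borel_measurable M" using integrable_DA[OF I assms(3)] by auto
  show "(\<integral>\<^sup>+x. ennreal (\<bar>DA \<alpha> k U x\<bar> ^ 2) \<partial>M) \<le> (\<integral>\<^sup>+x. ennreal (\<bar>D k U x\<bar> ^ 2) \<partial>M)"
    by (rule nn_integral_DA_power_le[OF I assms(3-5)])
qed

end

section \<open>Gaussian smoothing of the gradient\<close>

text \<open>\<open>L\<close> and \<open>L2\<close> will be Lip(g) and M_2(g), and \<open>K\<close>
  will be |C^-1|^(1/2) as a bound for the norm of the inverse of \<open>A\<close>.\<close>

locale gaussian_smoothing =
  fixes g :: "real^'d \<Rightarrow> real" and A a :: "real^'d^'d" and L L2 K :: real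
  assumes g_diff: "\<And>x. g differentiable (at x)"
    and grad_cont: "continuous_on UNIV (gradient g)"
    and g_lip: "\<And>x y. \<bar>g x - g y\<bar> \<le> L * norm (x - y)"
    and grad_lip: "\<And>x y. norm (gradient g x - gradient g y) \<le> L2 * norm (x - y)"
    and A_a: "A ** a = mat 1"
    and a_bound: "\<And>w. norm (a *v w) \<le> K * norm w"
    and nonneg: "0 \<le> L" "0 \<le> L2" "0 \<le> K"
begin

sublocale gauss: prob_space "std_gaussian :: (real^'d) measure" by (rule prob_space_std_gaussian)

abbreviation \<gamma> :: "(real^'d) measure" where "\<gamma> \<equiv> std_gaussian"

definition V :: "real \<Rightarrow> real \<Rightarrow> real^'d \<Rightarrow> real^'d \<Rightarrow> real^'d" where
  "V s c x z = gradient g (s *\<^sub>R x + c *\<^sub>R (A *v z))"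

text \<open>The map m of the interpolation, with \<open>s\<close> and \<open>c\<close> as free
  parameters in place of sin t and cos t.\<close>

definition mean_grad :: "real \<Rightarrow> real \<Rightarrow> real^'d \<Rightarrow> real^'d" where
  "mean_grad s c x = (\<chi> i. \<integral>z. V s c x z $ i \<partial>\<gamma>)"

text \<open>
  Here \<open>A ** transpose A = C\<close> and \<open>a\<close> is the inverse of \<open>A\<close>, so that \<open>Y = A *v z\<close> and
  \<open>z \<bullet> (a *v axis j 1)\<close> is the \<open>j\<close>-th coordinate of \<open>matrix_inv C *v Y\<close>. By Gaussian integration
  by parts \<open>W s c x\<close> is \<open>c\<close> times the mean Hessian of \<open>g\<close> at \<open>s *\<^sub>R x + c *\<^sub>R Y\<close>; written
  with the gradient alone it is bounded by the Lipschitz constant of \<open>g\<close>.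
\<close>

definition W :: "real \<Rightarrow> real \<Rightarrow> real^'d \<Rightarrow> 'd \<Rightarrow> 'd \<Rightarrow> real" where
  "W s c x i j = (\<integral>z. V s c x z $ i * (z \<bullet> (a *v axis j 1)) \<partial>\<gamma>)"

lemma grad_bound: "norm (gradient g x) \<le> L"
  by (rule norm_gradient_le[OF g_diff g_lip])

lemma A_measurable [measurable]: "(\<lambda>z. A *v z) \<in> borel_measurable borel"
  by (intro borel_measurable_continuous_onI linear_continuous_on matrix_vector_mul_bounded_linear)

lemma grad_measurable [measurable]: "gradient g \<in> borel_measurable borel"
  by (intro borel_measurable_continuous_onI grad_cont)

lemma V_measurable [measurable]: "(\<lambda>z. V s c x z) \<in> borel_measurable borel"
  unfolding V_def by measurable

lemma V_measurable_pair: "(\<lambda>(x, z). V s c x z) \<in> borel_measurable (borel \<Otimes>\<^sub>M borel)"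
  unfolding V_def by measurable

lemma V_bound: "norm (V s c x z) \<le> L" "\<bar>V s c x z $ i\<bar> \<le> L" "\<bar>V s c x z \<bullet> v\<bar> \<le> L * norm v"
proof -
  show V: "norm (V s c x z) \<le> L" by (simp add: V_def grad_bound)
  show "\<bar>V s c x z $ i\<bar> \<le> L" by (rule order_trans[OF component_le_norm_cart V])
  show "\<bar>V s c x z \<bullet> v\<bar> \<le> L * norm v"
    by (rule order_trans[OF Cauchy_Schwarz_ineq2]) (intro mult_right_mono V norm_ge_zero)
qed

lemma V_integrable:
  "integrable \<gamma> (\<lambda>z. V s c x z $ i)" "integrable \<gamma> (\<lambda>z. V s c x z \<bullet> v)"
proof -
  show "integrable \<gamma> (\<lambda>z. V s c x z $ i)"
    by (rule gauss.integrable_const_bound[where B=L]) (auto simp: V_bound)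
  show "integrable \<gamma> (\<lambda>z. V s c x z \<bullet> v)"
    by (rule gauss.integrable_const_bound[where B="L * norm v"]) (auto simp: V_bound)
qed

lemma V_mult_integrable:
  assumes "integrable \<gamma> h"
  shows "integrable \<gamma> (\<lambda>z. V s c x z $ i * h z)"
proof (rule Bochner_Integration.integrable_bound)
  have [measurable]: "h \<in> borel_measurable borel" using borel_measurable_integrable[OF assms] by simp
  show "integrable \<gamma> (\<lambda>z. L * h z)" using assms by simp
  show "(\<lambda>z. V s c x z $ i * h z) \<in> borel_measurable \<gamma>" by measurable
  show "AE z in \<gamma>. norm (V s c x z $ i * h z) \<le> norm (L * h z)"
    using V_bound nonneg by (auto simp: abs_mult intro!: mult_right_mono)
qed

lemma mean_grad_inner: "mean_grad s c x \<bullet> v = (\<integral>z. V s c x z \<bullet> v \<partial>\<gamma>)"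
proof -
  have "(\<integral>z. V s c x z \<bullet> v \<partial>\<gamma>) = (\<integral>z. (\<Sum>i\<in>UNIV. V s c x z $ i * v $ i) \<partial>\<gamma>)"
    by (simp add: inner_vec_def)
  also have "\<dots> = (\<Sum>i\<in>UNIV. (\<integral>z. V s c x z $ i \<partial>\<gamma>) * v $ i)"
    by (subst Bochner_Integration.integral_sum) (auto intro!: V_integrable)
  finally show ?thesis by (simp add: mean_grad_def inner_vec_def)
qed

lemma mean_grad_bound: "\<bar>mean_grad s c x \<bullet> v\<bar> \<le> L * norm v"
proof -
  have "\<bar>mean_grad s c x \<bullet> v\<bar> \<le> (\<integral>z. \<bar>V s c x z \<bullet> v\<bar> \<partial>\<gamma>)"
    unfolding mean_grad_inner by (rule integral_abs_bound)
  also have "\<dots> \<le> (\<integral>z. L * norm v \<partial>\<gamma>)"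
    by (intro integral_mono integrable_abs V_integrable V_bound) auto
  finally show ?thesis by (simp add: gauss.prob_space[simplified])
qed

lemma mean_grad_measurable [measurable]: "mean_grad s c \<in> borel_measurable borel"
proof -
  have "(\<lambda>x. \<integral>z. V s c x z $ i \<partial>\<gamma>) \<in> borel_measurable borel" for i
    using measurable_compose[OF V_measurable_pair, of "\<lambda>y. y $ i" borel]
    by (intro gauss.borel_measurable_lebesgue_integral) (auto simp: split_def)
  then show ?thesis by (intro borel_measurable_vecI) (simp add: mean_grad_def)
qed

lemma W_measurable [measurable]: "(\<lambda>x. W s c x i j) \<in> borel_measurable borel"
proof -
  have [measurable]: "(\<lambda>p. V s c (fst p) (snd p) $ i) \<in> borel_measurable (borel \<Otimes>\<^sub>M \<gamma>)"
    using measurable_compose[OF V_measurable_pair, of "\<lambda>y. y $ i" borel] by (simp add: split_def)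
  show ?thesis unfolding W_def
    by (intro gauss.borel_measurable_lebesgue_integral) (simp add: split_def, measurable)
qed

text \<open>Linearity recombines the columns of \<open>a\<close> into \<open>a\<close> applied to a
  whole row of \<open>B\<close>. Both the norm bound and the evaluation at B = C start from this
  form.\<close>

lemma sum_W:
  "(\<Sum>i\<in>UNIV. \<Sum>j\<in>UNIV. W s c x i j * B $ i $ j) = (\<integral>z. (V s c x z \<bullet> (\<chi> i. z \<bullet> (a *v (B $ i)))) \<partial>\<gamma>)"
proof -
  have *: "z \<bullet> (a *v w) = (\<Sum>j\<in>UNIV. (z \<bullet> (a *v axis j 1)) * w $ j)" for z w
  proof -
    have "a *v w = a *v (\<Sum>j\<in>UNIV. w $ j *\<^sub>R axis j 1)"
      by (simp add: basis_expansion scalar_mult_eq_scaleR[symmetric])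
    also have "\<dots> = (\<Sum>j\<in>UNIV. w $ j *\<^sub>R (a *v axis j 1))"
      by (simp add: linear_sum[OF matrix_vector_mul_linear] linear_cmul[OF matrix_vector_mul_linear])
    finally show ?thesis by (simp add: inner_sum_right mult.commute)
  qed
  have "(\<integral>z. (V s c x z \<bullet> (\<chi> i. z \<bullet> (a *v (B $ i)))) \<partial>\<gamma>)
     = (\<integral>z. (\<Sum>i\<in>UNIV. \<Sum>j\<in>UNIV. (V s c x z $ i * (z \<bullet> (a *v axis j 1))) * B $ i $ j) \<partial>\<gamma>)"
    by (simp add: inner_vec_def[of "V s c x _"] *[of _ "B $ _"] sum_distrib_left mult.assoc)
  also have "\<dots> = (\<Sum>i\<in>UNIV. \<Sum>j\<in>UNIV. W s c x i j * B $ i $ j)"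
    unfolding W_def
    by (simp add: Bochner_Integration.integral_sum Bochner_Integration.integrable_sum
        V_mult_integrable std_gaussian_inner)
  finally show ?thesis by simp
qed

text \<open>The gradient is bounded by \<open>L\<close>, and the mean norm of \<open>y\<close> by
  the root of its second moment, which is the sum of the squared norms of \<open>a\<close> times the
  rows of \<open>B\<close>. Here \<open>norm B\<close> is the Frobenius norm, so no dimensional
  factor appears.\<close>

lemma sum_W_bound: "\<bar>\<Sum>i\<in>UNIV. \<Sum>j\<in>UNIV. W s c x i j * B $ i $ j\<bar> \<le> L * K * norm B"
proof -
  define y where "y z = (\<chi> i. z \<bullet> (a *v (B $ i)))" for z
  have y2: "(norm (y z))\<^sup>2 = (\<Sum>i\<in>UNIV. (z \<bullet> (a *v (B $ i)))\<^sup>2)" for z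
    by (simp add: y_def norm_vec_def L2_set_def sum_nonneg)
  have ymeas: "y \<in> borel_measurable \<gamma>"
    by (intro borel_measurable_vecI) (simp add: y_def)
  have i2: "integrable \<gamma> (\<lambda>z. (norm (y z))\<^sup>2)"
    unfolding y2 by (intro Bochner_Integration.integrable_sum std_gaussian_inner)
  have "(\<integral>z. \<bar>norm (y z)\<bar> \<partial>\<gamma>) \<le> sqrt (\<integral>z. (norm (y z))\<^sup>2 \<partial>\<gamma>)"
    using ymeas i2 by (intro gauss.expectation_abs_le_sqrt) auto
  also have "(\<integral>z. (norm (y z))\<^sup>2 \<partial>\<gamma>) = (\<Sum>i\<in>UNIV. (norm (a *v (B $ i)))\<^sup>2)"
    unfolding y2 by (simp add: Bochner_Integration.integral_sum std_gaussian_inner)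
  also have "\<dots> \<le> (\<Sum>i\<in>UNIV. (K * norm (B $ i))\<^sup>2)"
    by (intro sum_mono power_mono a_bound) auto
  also have "\<dots> = (K * norm B)\<^sup>2"
    by (simp add: norm_vec_def[of B] L2_set_def sum_nonneg power_mult_distrib sum_distrib_left)
  finally have ny: "(\<integral>z. norm (y z) \<partial>\<gamma>) \<le> K * norm B" using nonneg by simp
  have iy: "integrable \<gamma> (\<lambda>z. norm (y z))"
    using gauss.square_integrable_imp_integrable[OF _ i2] ymeas by simp
  have "\<bar>\<integral>z. (V s c x z \<bullet> y z) \<partial>\<gamma>\<bar> \<le> (\<integral>z. \<bar>V s c x z \<bullet> y z\<bar> \<partial>\<gamma>)"
    by (rule integral_abs_bound)
  also have "\<dots> \<le> (\<integral>z. L * norm (y z) \<partial>\<gamma>)"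
    using iy by (intro integral_mono' V_bound mult_nonneg_nonneg nonneg) auto
  also have "\<dots> \<le> L * (K * norm B)" using ny nonneg by (simp add: mult_left_mono)
  finally show ?thesis unfolding sum_W y_def by (simp add: mult.assoc)
qed

text \<open>Row i of A A^T is \<open>A\<close> applied to row i of \<open>A\<close>. The matrix
  \<open>a\<close> undoes this \<open>A\<close>, and the linear forms reassemble into A z.\<close>

lemma sum_W_covariance:
  assumes C: "C = A ** transpose A"
  shows "(\<Sum>i\<in>UNIV. \<Sum>j\<in>UNIV. W s c x i j * C $ i $ j) = (\<integral>z. V s c x z \<bullet> (A *v z) \<partial>\<gamma>)"
proof -
  have aA: "a ** A = mat 1" using A_a by (simp add: matrix_left_right_inverse)
  have row: "C $ i = A *v (A $ i)" for i
    by (simp add: C vec_eq_iff matrix_matrix_mult_def transpose_def matrix_vector_mult_def mult.commute)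
  have "a *v (C $ i) = A $ i" for i
    by (simp add: row matrix_vector_mul_assoc aA)
  then have "(\<chi> i. z \<bullet> (a *v (C $ i))) = A *v z" for z
    by (simp add: vec_eq_iff matrix_vector_mult_def inner_vec_def mult.commute)
  then show ?thesis by (simp add: sum_W)
qed

text \<open>Moving the base point by \<delta> amounts to translating the Gaussian variable by \<eta>
  = (s / c) a \<delta>. The slope is taken at the shifted end, that is at \<open>x\<close>, and the
  leading factor \<open>c\<close> cancels the 1/c in \<eta>.\<close>

lemma mean_grad_expansion:
  assumes c: "0 < c" and s: "0 \<le> s"
  shows "\<bar>c * ((mean_grad s c x - mean_grad s c (x - \<delta>)) \<bullet> v) - s * (\<Sum>i\<in>UNIV. \<Sum>j\<in>UNIV. W s c x i j * (v $ i * \<delta> $ j))\<bar>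
          \<le> s * (s * L2 * K * norm v * (norm \<delta>)\<^sup>2)"
proof -
  define \<eta> where "\<eta> = (s / c) *\<^sub>R (a *v \<delta>)"
  define q where "q z = V s c (x - \<delta>) z \<bullet> v" for z
  have A\<eta>: "c *\<^sub>R (A *v (u *\<^sub>R \<eta>)) = (u * s) *\<^sub>R \<delta>" for u
  proof -
    have "A *v (u *\<^sub>R \<eta>) = (u * (s / c)) *\<^sub>R (A *v (a *v \<delta>))"
      by (simp add: \<eta>_def linear_cmul[OF matrix_vector_mul_linear])
    then show ?thesis using c by (simp add: matrix_vector_mul_assoc A_a)
  qed
  have shift: "V s c (x - \<delta>) (z + u *\<^sub>R \<eta>) = gradient g (s *\<^sub>R x + c *\<^sub>R (A *v z) - ((1 - u) * s) *\<^sub>R \<delta>)" for z u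
  proof -
    have "c *\<^sub>R (A *v (z + u *\<^sub>R \<eta>)) = c *\<^sub>R (A *v z) + (u * s) *\<^sub>R \<delta>"
      unfolding matrix_vector_right_distrib scaleR_add_right A\<eta> ..
    then show ?thesis by (simp add: V_def algebra_simps)
  qed
  have q1: "q (z + \<eta>) = V s c x z \<bullet> v" for z
    using shift[of z 1] by (simp add: q_def V_def)
  have l: "\<bar>q (z + u *\<^sub>R \<eta>) - q (z + \<eta>)\<bar> \<le> L2 * (s * norm \<delta>) * norm v" if u: "0 \<le> u" "u \<le> 1" for z u
  proof -
    let ?p = "s *\<^sub>R x + c *\<^sub>R (A *v z)"
    have "q (z + u *\<^sub>R \<eta>) - q (z + \<eta>) = (gradient g (?p - ((1 - u) * s) *\<^sub>R \<delta>) - gradient g ?p) \<bullet> v"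
      unfolding q1 q_def[of "z + u *\<^sub>R \<eta>"] shift by (simp add: V_def inner_diff_left)
    also have "\<bar>\<dots>\<bar> \<le> norm (gradient g (?p - ((1 - u) * s) *\<^sub>R \<delta>) - gradient g ?p) * norm v"
      by (rule Cauchy_Schwarz_ineq2)
    also have "\<dots> \<le> (L2 * norm (((1 - u) * s) *\<^sub>R \<delta>)) * norm v"
      using grad_lip[of "?p - ((1 - u) * s) *\<^sub>R \<delta>" ?p] by (intro mult_right_mono) auto
    also have "norm (((1 - u) * s) *\<^sub>R \<delta>) \<le> s * norm \<delta>"
    proof -
      have "(1 - u) * s \<le> s" using u s mult_right_mono[of "1 - u" 1 s] by simp
      then show ?thesis using u s by (auto simp: abs_mult intro!: mult_right_mono)
    qed
    finally show ?thesis using nonneg by (simp add: mult_left_mono mult_right_mono)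
  qed
  have "\<bar>(\<integral>z. q (z + \<eta>) \<partial>\<gamma>) - (\<integral>z. q z \<partial>\<gamma>) - (\<integral>z. q (z + \<eta>) * (z \<bullet> \<eta>) \<partial>\<gamma>)\<bar>
     \<le> (L2 * (s * norm \<delta>) * norm v) * norm \<eta>"
    by (rule std_gaussian_translation_expansion[where B="L * norm v", OF _ _ l])
       (auto simp: q_def V_bound)
  also have "(\<integral>z. q (z + \<eta>) \<partial>\<gamma>) = mean_grad s c x \<bullet> v" by (simp add: q1 mean_grad_inner)
  also have "(\<integral>z. q z \<partial>\<gamma>) = mean_grad s c (x - \<delta>) \<bullet> v" by (simp add: q_def mean_grad_inner)
  also have "(\<integral>z. q (z + \<eta>) * (z \<bullet> \<eta>) \<partial>\<gamma>) = (s / c) * (\<Sum>i\<in>UNIV. \<Sum>j\<in>UNIV. W s c x i j * (v $ i * \<delta> $ j))"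
  proof -
    \<comment> \<open>The coefficient pairs \<open>W\<close> with the rank-one matrix v \<delta>^T.
      Its i-th row is v_i \<delta>, so the integrand in \<open>sum_W\<close> factors.\<close>
    have "(\<Sum>i\<in>UNIV. \<Sum>j\<in>UNIV. W s c x i j * (v $ i * \<delta> $ j))
      = (\<Sum>i\<in>UNIV. \<Sum>j\<in>UNIV. W s c x i j * (\<chi> i. v $ i *\<^sub>R \<delta>) $ i $ j)" by simp
    also have "\<dots> = (\<integral>z. V s c x z \<bullet> (\<chi> i. z \<bullet> (a *v (v $ i *\<^sub>R \<delta>))) \<partial>\<gamma>)"
      unfolding sum_W by simp
    also have "(\<lambda>z. V s c x z \<bullet> (\<chi> i. z \<bullet> (a *v (v $ i *\<^sub>R \<delta>)))) = (\<lambda>z. (V s c x z \<bullet> v) * (z \<bullet> (a *v \<delta>)))"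
      by (simp add: fun_eq_iff inner_vec_def[of "V s c x _"] linear_cmul[OF matrix_vector_mul_linear]
          sum_distrib_right mult.assoc)
    finally show ?thesis unfolding q1 by (simp add: \<eta>_def mult.left_commute)
  qed
  finally have main: "\<bar>mean_grad s c x \<bullet> v - mean_grad s c (x - \<delta>) \<bullet> v - (s / c) * (\<Sum>i\<in>UNIV. \<Sum>j\<in>UNIV. W s c x i j * (v $ i * \<delta> $ j))\<bar>
     \<le> (L2 * (s * norm \<delta>) * norm v) * norm \<eta>" (is "\<bar>?X\<bar> \<le> _") .
  have "c * norm \<eta> \<le> s * (K * norm \<delta>)"
    using c s mult_left_mono[OF a_bound[of \<delta>] s] by (simp add: \<eta>_def)
  then have "(L2 * (s * norm \<delta>) * norm v) * (c * norm \<eta>) \<le> (L2 * (s * norm \<delta>) * norm v) * (s * (K * norm \<delta>))"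
    using nonneg s by (intro mult_left_mono) auto
  moreover have "\<bar>c * ?X\<bar> \<le> c * ((L2 * (s * norm \<delta>) * norm v) * norm \<eta>)"
    unfolding abs_mult using main c by (simp add: mult_left_mono)
  moreover have "c * ?X = c * ((mean_grad s c x - mean_grad s c (x - \<delta>)) \<bullet> v) - s * (\<Sum>i\<in>UNIV. \<Sum>j\<in>UNIV. W s c x i j * (v $ i * \<delta> $ j))"
    using c by (simp add: algebra_simps inner_diff_left)
  ultimately show ?thesis by (simp add: power2_eq_square ac_simps)
qed

end

section \<open>Comparison along the interpolation\<close>

locale gaussian_comparison =
  finite_independent_family M S X n + gaussian_smoothing g A a L L2 K
  for M :: "'a measure" and S :: "'x measure" and X n
    and g :: "real^'d \<Rightarrow> real" and A a :: "real^'d^'d" and L L2 K +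
  fixes F :: "'a \<Rightarrow> real^'d" and \<alpha> :: real
  assumes F_G: "\<And>i. (\<lambda>x. F x $ i) \<in> borel_measurable (G {1..n})"
    and F_square: "\<And>i. integrable M (\<lambda>x. (F x $ i)\<^sup>2)"
    and F_mean: "\<And>i. expectation (\<lambda>x. F x $ i) = 0"
    and \<alpha>: "0 \<le> \<alpha>" "\<alpha> \<le> 1"
begin

definition DF :: "nat \<Rightarrow> 'a \<Rightarrow> real^'d" where "DF k x = (\<chi> i. D k (\<lambda>x. F x $ i) x)"
definition TF :: "nat \<Rightarrow> 'a \<Rightarrow> real^'d" where "TF k x = (\<chi> i. DA \<alpha> k (\<lambda>x. F x $ i) x)"
text \<open>The transpose of \<open>Z\<close>, which is what pairs with \<open>W\<close> below.\<close>

definition ZT :: "'a \<Rightarrow> real^'d^'d" where "ZT x = (\<chi> i j. Z_alpha M S n X \<alpha> F j i x)"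

lemma F_comp_measurable: "(\<lambda>x. F x $ i) \<in> borel_measurable M"
  by (rule measurable_G_M[OF F_G]) simp

lemma F_measurable [measurable]: "F \<in> borel_measurable M"
  by (intro borel_measurable_vecI F_comp_measurable)

lemma F_integrable: "integrable M (\<lambda>x. F x $ i)"
  by (rule square_integrable_imp_integrable[OF F_comp_measurable F_square])

lemma DF_integrable: "integrable M (\<lambda>x. DF k x $ i)"
  unfolding DF_def vec_lambda_beta by (rule integrable_D[OF F_integrable])

lemma TF_integrable: "k \<in> {1..n} \<Longrightarrow> integrable M (\<lambda>x. TF k x $ i)"
  unfolding TF_def vec_lambda_beta by (rule integrable_DA[OF F_integrable])

lemma DF_measurable [measurable]: "DF k \<in> borel_measurable M"
  by (intro borel_measurable_vecI borel_measurable_integrable DF_integrable)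

lemma TF_measurable: "k \<in> {1..n} \<Longrightarrow> TF k \<in> borel_measurable M"
  by (intro borel_measurable_vecI borel_measurable_integrable TF_integrable)

lemma mean_grad_mult_integrable:
  assumes [measurable]: "Y \<in> borel_measurable M" "T \<in> borel_measurable M" and T: "\<And>i. integrable M (\<lambda>x. T x $ i)"
  shows "integrable M (\<lambda>x. mean_grad s c (Y x) \<bullet> T x)"
    and "integrable M (\<lambda>x. mean_grad s c (Y x) $ i * T x $ i)"
proof -
  have m: "(\<lambda>x. mean_grad s c (Y x)) \<in> borel_measurable M" by measurable
  show "integrable M (\<lambda>x. mean_grad s c (Y x) \<bullet> T x)"
  proof (rule Bochner_Integration.integrable_bound)
    show "integrable M (\<lambda>x. L * norm (T x))" by (intro integrable_mult_right norm_vec_integrable T)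
    show "AE x in M. norm (mean_grad s c (Y x) \<bullet> T x) \<le> norm (L * norm (T x))"
      using nonneg by (auto intro!: AE_I2 order_trans[OF mean_grad_bound])
  qed (use m in measurable)
  show "integrable M (\<lambda>x. mean_grad s c (Y x) $ i * T x $ i)"
  proof (rule Bochner_Integration.integrable_bound)
    show "integrable M (\<lambda>x. L * T x $ i)" by (intro integrable_mult_right T)
    have "\<bar>mean_grad s c y $ i\<bar> \<le> L" for y
      using mean_grad_bound[of s c y "axis i 1"] by (simp add: inner_axis)
    then show "AE x in M. norm (mean_grad s c (Y x) $ i * T x $ i) \<le> norm (L * T x $ i)"
      using nonneg by (auto simp: abs_mult intro!: AE_I2 mult_right_mono)
  qed (use m in measurable)
qed

lemma integral_mean_grad_F:
  "(\<integral>x. mean_grad s c (F x) \<bullet> F x \<partial>M) =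
     (\<Sum>k=1..n. \<integral>x. (mean_grad s c (F x) - mean_grad s c (F x - DF k x)) \<bullet> TF k x \<partial>M)"
proof -
  note int = mean_grad_mult_integrable[OF _ TF_measurable TF_integrable]
  have "AE x in M. \<forall>i\<in>UNIV. (\<Sum>k=1..n. DA \<alpha> k (\<lambda>x. F x $ i) x) = F x $ i"
    by (rule AE_finite_allI) (use sum_DA[OF F_integrable F_G, of \<alpha>] in \<open>auto simp: F_mean\<close>)
  then have "AE x in M. mean_grad s c (F x) \<bullet> F x = (\<Sum>k=1..n. mean_grad s c (F x) \<bullet> TF k x)"
  proof eventually_elim
    case (elim x)
    have "F x = (\<Sum>k=1..n. TF k x)" using elim by (simp add: vec_eq_iff TF_def)
    then show ?case by (metis inner_sum_right)
  qed
  then have "(\<integral>x. mean_grad s c (F x) \<bullet> F x \<partial>M) = (\<integral>x. (\<Sum>k=1..n. mean_grad s c (F x) \<bullet> TF k x) \<partial>M)"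
    using TF_measurable by (intro integral_cong_AE borel_measurable_sum borel_measurable_inner) (measurable, auto)
  also have "\<dots> = (\<Sum>k=1..n. \<integral>x. mean_grad s c (F x) \<bullet> TF k x \<partial>M)"
    by (intro Bochner_Integration.integral_sum int) auto
  also have "\<dots> = (\<Sum>k=1..n. \<integral>x. (mean_grad s c (F x) - mean_grad s c (F x - DF k x)) \<bullet> TF k x \<partial>M)"
  proof (rule sum.cong[OF refl])
    fix k assume k: "k \<in> {1..n}"
    \<comment> \<open>This holds at every point by the definition of \<open>diff_op\<close>, which
      gives exact measurability with respect to the other variables, not merely up to a null
      set.\<close>
    have "F x - DF k x = (\<chi> i. E ({1..n} - {k}) (\<lambda>x. F x $ i) x)" for x
      by (simp add: DF_def diff_op_def vec_eq_iff)
    then have m: "(\<lambda>x. F x - DF k x) \<in> borel_measurable (G ({1..n} - {k}))"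
      by (intro borel_measurable_vecI) simp
    have [measurable]: "(\<lambda>x. F x - DF k x) \<in> borel_measurable M" by measurable
    \<comment> \<open>The orthogonality relation is scalar, so the inner product is expanded into
      coordinates before it is applied.\<close>
    have "(\<integral>x. mean_grad s c (F x - DF k x) \<bullet> TF k x \<partial>M)
        = (\<integral>x. (\<Sum>i\<in>UNIV. mean_grad s c (F x - DF k x) $ i * TF k x $ i) \<partial>M)"
      by (simp add: inner_vec_def)
    also have "\<dots> = (\<Sum>i\<in>UNIV. \<integral>x. mean_grad s c (F x - DF k x) $ i * TF k x $ i \<partial>M)"
      by (intro Bochner_Integration.integral_sum int) (use k in auto)
    also have "\<dots> = 0"
    proof (rule sum.neutral, rule)
      fix i
      have "(\<lambda>x. mean_grad s c (F x - DF k x) $ i) \<in> borel_measurable (G ({1..n} - {k}))"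
        using measurable_compose[OF m mean_grad_measurable] by (rule borel_measurable_vec_nth)
      then show "(\<integral>x. mean_grad s c (F x - DF k x) $ i * TF k x $ i \<partial>M) = 0"
        using int(2)[OF _ k k, of "\<lambda>x. F x - DF k x" s c i] k
        unfolding TF_def vec_lambda_beta by (intro integral_mult_DA_zero F_integrable) auto
    qed
    finally have "(\<integral>x. mean_grad s c (F x - DF k x) \<bullet> TF k x \<partial>M) = 0" .
    then show "(\<integral>x. mean_grad s c (F x) \<bullet> TF k x \<partial>M) =
      (\<integral>x. (mean_grad s c (F x) - mean_grad s c (F x - DF k x)) \<bullet> TF k x \<partial>M)"
      unfolding inner_diff_left by (subst Bochner_Integration.integral_diff) (use int(1) k in auto)
  qed
  finally show ?thesis .
qed

text \<open>The bound produced by the interpolation, before its constants are enlarged to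
  \<open>B1\<close> and \<open>B2\<close>. It is an extended real because the third-order term may
  be infinite.\<close>

definition stein_bound :: "real^'d^'d \<Rightarrow> ennreal" where
  "stein_bound C = ennreal (L * K) * (\<integral>\<^sup>+x. ennreal (norm (ZT x - C)) \<partial>M)
     + ennreal (L2 * K) * (\<Sum>k=1..n. \<integral>\<^sup>+x. ennreal (norm (TF k x) * (norm (DF k x))\<^sup>2) \<partial>M)"

lemma Z_measurable: "Z_alpha M S n X \<alpha> F i j \<in> borel_measurable M"
proof -
  have "(\<lambda>x. \<Sum>k=1..n. DF k x $ i * TF k x $ j) \<in> borel_measurable M"
    using TF_measurable by (intro borel_measurable_sum borel_measurable_times borel_measurable_vec_nth) auto
  then show ?thesis by (simp add: Z_alpha_def DF_def TF_def)
qed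

lemma ZT_measurable [measurable]: "(\<lambda>x. norm (ZT x - C)) \<in> borel_measurable M"
proof -
  have "(\<lambda>x. norm (ZT x - C)) = (\<lambda>x. sqrt (\<Sum>i\<in>UNIV. \<Sum>j\<in>UNIV. (Z_alpha M S n X \<alpha> F j i x - C $ i $ j)\<^sup>2))"
    by (simp add: fun_eq_iff norm_vec_def L2_set_def sum_nonneg ZT_def)
  then show ?thesis using Z_measurable by simp
qed

text \<open>The integrand is rewritten as s times the pairing of \<open>W\<close> with Z^T - C plus
  one expansion remainder per \<open>k\<close>. This splitting is estimated pointwise, before
  integration, so the signed integrand stays integrable even when the majorant is not.\<close>

lemma stein_identity_bound:
  assumes s: "0 \<le> s" "s \<le> 1" and c: "0 < c"
  shows "ennreal \<bar>\<integral>x. c * (mean_grad s c (F x) \<bullet> F x) - s * (\<Sum>i\<in>UNIV. \<Sum>j\<in>UNIV. W s c (F x) i j * C $ i $ j) \<partial>M\<bar>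
           \<le> ennreal s * stein_bound C"
proof -
  define R where "R x = (\<Sum>k=1..n. c * ((mean_grad s c (F x) - mean_grad s c (F x - DF k x)) \<bullet> TF k x))
      - s * (\<Sum>i\<in>UNIV. \<Sum>j\<in>UNIV. W s c (F x) i j * C $ i $ j)" for x
  have int: "integrable M (\<lambda>x. c * ((mean_grad s c (F x) - mean_grad s c (F x - DF k x)) \<bullet> TF k x))" if "k \<in> {1..n}" for k
    unfolding inner_diff_left
    by (intro integrable_mult_right Bochner_Integration.integrable_diff mean_grad_mult_integrable TF_measurable TF_integrable that) measurable
  have intW: "integrable M (\<lambda>x. s * (\<Sum>i\<in>UNIV. \<Sum>j\<in>UNIV. W s c (F x) i j * C $ i $ j))"
  proof (rule integrable_const_bound)
    show "AE x in M. norm (s * (\<Sum>i\<in>UNIV. \<Sum>j\<in>UNIV. W s c (F x) i j * C $ i $ j)) \<le> s * (L * K * norm C)"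
      using s by (intro AE_I2) (auto simp: abs_mult intro!: mult_left_mono sum_W_bound)
  qed measurable
  have intS: "integrable M (\<lambda>x. \<Sum>k=1..n. c * ((mean_grad s c (F x) - mean_grad s c (F x - DF k x)) \<bullet> TF k x))"
    by (rule Bochner_Integration.integrable_sum, rule int)
  have eqS: "(\<integral>x. (\<Sum>k=1..n. c * ((mean_grad s c (F x) - mean_grad s c (F x - DF k x)) \<bullet> TF k x)) \<partial>M)
     = (\<Sum>k=1..n. \<integral>x. c * ((mean_grad s c (F x) - mean_grad s c (F x - DF k x)) \<bullet> TF k x) \<partial>M)"
    by (rule Bochner_Integration.integral_sum, rule int)
  have Rint: "integrable M R" unfolding R_def
    by (rule Bochner_Integration.integrable_diff[OF intS intW])
  have intF: "integrable M (\<lambda>x. c * (mean_grad s c (F x) \<bullet> F x))"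
    by (intro integrable_mult_right mean_grad_mult_integrable F_integrable) measurable
  have "(\<integral>x. c * (mean_grad s c (F x) \<bullet> F x) - s * (\<Sum>i\<in>UNIV. \<Sum>j\<in>UNIV. W s c (F x) i j * C $ i $ j) \<partial>M)
     = c * (\<integral>x. mean_grad s c (F x) \<bullet> F x \<partial>M) - (\<integral>x. s * (\<Sum>i\<in>UNIV. \<Sum>j\<in>UNIV. W s c (F x) i j * C $ i $ j) \<partial>M)"
    by (subst Bochner_Integration.integral_diff[OF intF intW]) simp
  also have "c * (\<integral>x. mean_grad s c (F x) \<bullet> F x \<partial>M) =
     (\<Sum>k=1..n. \<integral>x. c * ((mean_grad s c (F x) - mean_grad s c (F x - DF k x)) \<bullet> TF k x) \<partial>M)"
    by (simp add: integral_mean_grad_F sum_distrib_left)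
  also have "\<dots> - (\<integral>x. s * (\<Sum>i\<in>UNIV. \<Sum>j\<in>UNIV. W s c (F x) i j * C $ i $ j) \<partial>M) = (\<integral>x. R x \<partial>M)"
    unfolding R_def by (simp only: Bochner_Integration.integral_diff[OF intS intW] eqS)
  finally have eq: "(\<integral>x. c * (mean_grad s c (F x) \<bullet> F x) - s * (\<Sum>i\<in>UNIV. \<Sum>j\<in>UNIV. W s c (F x) i j * C $ i $ j) \<partial>M)
     = (\<integral>x. R x \<partial>M)" .
  have pw: "\<bar>R x\<bar> \<le> s * (L * K * norm (ZT x - C)) + (\<Sum>k=1..n. s * (L2 * K * (norm (TF k x) * (norm (DF k x))\<^sup>2)))" for x
  proof -
    let ?r = "\<lambda>k. c * ((mean_grad s c (F x) - mean_grad s c (F x - DF k x)) \<bullet> TF k x)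
      - s * (\<Sum>i\<in>UNIV. \<Sum>j\<in>UNIV. W s c (F x) i j * (TF k x $ i * DF k x $ j))"
    have "(\<Sum>k=1..n. \<Sum>i\<in>UNIV. \<Sum>j\<in>UNIV. W s c (F x) i j * (TF k x $ i * DF k x $ j))
       = (\<Sum>i\<in>UNIV. \<Sum>j\<in>UNIV. \<Sum>k=1..n. W s c (F x) i j * (TF k x $ i * DF k x $ j))"
      by (subst sum.swap, intro sum.cong refl, rule sum.swap)
    also have "\<dots> = (\<Sum>i\<in>UNIV. \<Sum>j\<in>UNIV. W s c (F x) i j * ZT x $ i $ j)"
      by (simp add: ZT_def Z_alpha_def TF_def DF_def sum_distrib_left mult.commute)
    finally have 1: "(\<Sum>k=1..n. \<Sum>i\<in>UNIV. \<Sum>j\<in>UNIV. W s c (F x) i j * (TF k x $ i * DF k x $ j))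
       = (\<Sum>i\<in>UNIV. \<Sum>j\<in>UNIV. W s c (F x) i j * ZT x $ i $ j)" .
    have 2: "(\<Sum>k=1..n. ?r k) = (\<Sum>k=1..n. c * ((mean_grad s c (F x) - mean_grad s c (F x - DF k x)) \<bullet> TF k x))
       - s * (\<Sum>i\<in>UNIV. \<Sum>j\<in>UNIV. W s c (F x) i j * ZT x $ i $ j)"
      unfolding 1[symmetric] sum_distrib_left[of s] sum_subtractf ..
    have 3: "(\<Sum>i\<in>UNIV. \<Sum>j\<in>UNIV. W s c (F x) i j * (ZT x - C) $ i $ j) =
       (\<Sum>i\<in>UNIV. \<Sum>j\<in>UNIV. W s c (F x) i j * ZT x $ i $ j) - (\<Sum>i\<in>UNIV. \<Sum>j\<in>UNIV. W s c (F x) i j * C $ i $ j)"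
      by (simp only: vector_minus_component right_diff_distrib sum_subtractf)
    have Rx: "R x = s * (\<Sum>i\<in>UNIV. \<Sum>j\<in>UNIV. W s c (F x) i j * (ZT x - C) $ i $ j) + (\<Sum>k=1..n. ?r k)"
      unfolding R_def 2 3 right_diff_distrib[of s] by linarith
    show ?thesis unfolding Rx
    proof (intro order_trans[OF abs_triangle_ineq] add_mono order_trans[OF sum_abs] sum_mono)
      show "\<bar>s * (\<Sum>i\<in>UNIV. \<Sum>j\<in>UNIV. W s c (F x) i j * (ZT x - C) $ i $ j)\<bar> \<le> s * (L * K * norm (ZT x - C))"
        unfolding abs_mult abs_of_nonneg[OF s(1)] by (intro mult_left_mono sum_W_bound s)
      fix k
      have "\<bar>?r k\<bar> \<le> s * (s * L2 * K * norm (TF k x) * (norm (DF k x))\<^sup>2)"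
        by (rule mean_grad_expansion[OF c s(1)])
      also have "\<dots> = s * (s * (L2 * K * (norm (TF k x) * (norm (DF k x))\<^sup>2)))" by (simp add: ac_simps)
      \<comment> \<open>One of the two factors \<open>s\<close> is given up so that both parts carry
        the same weight \<open>s\<close>.\<close>
      also have "\<dots> \<le> s * (L2 * K * (norm (TF k x) * (norm (DF k x))\<^sup>2))"
        by (rule mult_left_le_one_le) (use s nonneg in auto)
      finally show "\<bar>?r k\<bar> \<le> s * (L2 * K * (norm (TF k x) * (norm (DF k x))\<^sup>2))" .
    qed
  qed
  have "ennreal \<bar>\<integral>x. R x \<partial>M\<bar> \<le> (\<integral>\<^sup>+x. ennreal \<bar>R x\<bar> \<partial>M)"
    using integral_norm_bound_ennreal[OF Rint] by simp
  also have "\<dots> \<le> (\<integral>\<^sup>+x. ennreal s * (ennreal (L * K) * ennreal (norm (ZT x - C))) +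
      (\<Sum>k=1..n. ennreal s * (ennreal (L2 * K) * ennreal (norm (TF k x) * (norm (DF k x))\<^sup>2))) \<partial>M)"
  proof (rule nn_integral_mono)
    fix x
    show "ennreal \<bar>R x\<bar> \<le> ennreal s * (ennreal (L * K) * ennreal (norm (ZT x - C))) +
      (\<Sum>k=1..n. ennreal s * (ennreal (L2 * K) * ennreal (norm (TF k x) * (norm (DF k x))\<^sup>2)))"
    proof -
      have "ennreal \<bar>R x\<bar> \<le> ennreal (s * (L * K * norm (ZT x - C)) + (\<Sum>k=1..n. s * (L2 * K * (norm (TF k x) * (norm (DF k x))\<^sup>2))))"
        by (rule ennreal_leI[OF pw])
      also have "\<dots> = ennreal (s * (L * K * norm (ZT x - C))) + ennreal (\<Sum>k=1..n. s * (L2 * K * (norm (TF k x) * (norm (DF k x))\<^sup>2)))"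
        by (rule ennreal_plus) (use s nonneg in \<open>auto intro!: sum_nonneg mult_nonneg_nonneg\<close>)
      also have "ennreal (\<Sum>k=1..n. s * (L2 * K * (norm (TF k x) * (norm (DF k x))\<^sup>2)))
          = (\<Sum>k=1..n. ennreal (s * (L2 * K * (norm (TF k x) * (norm (DF k x))\<^sup>2))))"
        by (rule sum_ennreal[symmetric]) (use s nonneg in auto)
      finally show ?thesis using s nonneg by (simp add: ennreal_mult)
    qed
  qed
  also have "\<dots> = ennreal s * stein_bound C"
  proof -
    have m: "(\<lambda>x. ennreal (norm (TF k x) * (norm (DF k x))\<^sup>2)) \<in> borel_measurable M" if "k \<in> {1..n}" for k
      using TF_measurable[OF that] by measurable
    have "(\<integral>\<^sup>+x. (\<Sum>k=1..n. ennreal s * (ennreal (L2 * K) * ennreal (norm (TF k x) * (norm (DF k x))\<^sup>2))) \<partial>M)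
      = (\<Sum>k=1..n. ennreal s * (ennreal (L2 * K) * (\<integral>\<^sup>+x. ennreal (norm (TF k x) * (norm (DF k x))\<^sup>2) \<partial>M)))"
      using m by (subst nn_integral_sum) (auto simp: nn_integral_cmult intro!: sum.cong)
    then show ?thesis
      using m by (subst nn_integral_add)
        (auto simp: nn_integral_cmult stein_bound_def distrib_left sum_distrib_left intro!: borel_measurable_sum)
  qed
  finally show ?thesis unfolding eq .
qed

section \<open>Moments of Z and the third-order remainder\<close>

lemma F_mult_integrable: "integrable M (\<lambda>x. F x $ i * F x $ j)"
  by (intro integrable_mult_of_squares F_comp_measurable F_square)

text \<open>E_k F_i is orthogonal to D^(alpha)_k F_j, so D_k F_i may be replaced by F_i; then the
  D^(alpha)_k F_j add up to F_j. Square integrability of F makes every product integrable.\<close>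

lemma Z_mean:
  "integrable M (Z_alpha M S n X \<alpha> F i j)"
  "expectation (Z_alpha M S n X \<alpha> F i j) = expectation (\<lambda>x. F x $ i * F x $ j)"
proof -
  let ?Fi = "\<lambda>x. F x $ i" and ?Fj = "\<lambda>x. F x $ j"
  let ?E = "\<lambda>k. E ({1..n} - {k}) ?Fi"
  have T: "integrable M (DA \<alpha> k ?Fj)" if "k \<in> {1..n}" for k by (rule integrable_DA[OF F_integrable that])
  have T2: "integrable M (\<lambda>x. (DA \<alpha> k ?Fj x)\<^sup>2)" if "k \<in> {1..n}" for k
    by (rule square_integrable_DA[OF F_comp_measurable F_square that \<alpha>])
  have FT: "integrable M (\<lambda>x. ?Fi x * DA \<alpha> k ?Fj x)" if "k \<in> {1..n}" for k
    by (rule integrable_mult_of_squares[OF F_comp_measurable borel_measurable_integrable[OF T[OF that]] F_square T2[OF that]])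
  have ET: "integrable M (\<lambda>x. ?E k x * DA \<alpha> k ?Fj x)" if "k \<in> {1..n}" for k
  proof (rule integrable_mult_of_squares[OF _ borel_measurable_integrable[OF T[OF that]] _ T2[OF that]])
    show "integrable M (\<lambda>x. (?E k x)\<^sup>2)" by (rule square_integrable_D[OF F_comp_measurable F_square])
    show "?E k \<in> borel_measurable M"
      by (rule borel_measurable_integrable[OF integrable_E[OF _ F_integrable]]) auto
  qed
  have eq: "D k ?Fi x * DA \<alpha> k ?Fj x = ?Fi x * DA \<alpha> k ?Fj x - ?E k x * DA \<alpha> k ?Fj x" for k x
    by (simp add: diff_op_def left_diff_distrib)
  have DT: "integrable M (\<lambda>x. D k ?Fi x * DA \<alpha> k ?Fj x)" if "k \<in> {1..n}" for k
    unfolding eq by (intro Bochner_Integration.integrable_diff FT ET that)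
  show "integrable M (Z_alpha M S n X \<alpha> F i j)"
    unfolding Z_alpha_def by (rule Bochner_Integration.integrable_sum, rule DT)
  have "expectation (Z_alpha M S n X \<alpha> F i j) = (\<Sum>k=1..n. \<integral>x. D k ?Fi x * DA \<alpha> k ?Fj x \<partial>M)"
    unfolding Z_alpha_def by (rule Bochner_Integration.integral_sum, rule DT)
  also have "\<dots> = (\<Sum>k=1..n. \<integral>x. ?Fi x * DA \<alpha> k ?Fj x \<partial>M)"
  proof (rule sum.cong[OF refl])
    fix k assume k: "k \<in> {1..n}"
    have "(\<integral>x. ?E k x * DA \<alpha> k ?Fj x \<partial>M) = 0"
      by (rule integral_mult_DA_zero[OF F_integrable k borel_measurable_cond_exp ET[OF k]])
    then show "(\<integral>x. D k ?Fi x * DA \<alpha> k ?Fj x \<partial>M) = (\<integral>x. ?Fi x * DA \<alpha> k ?Fj x \<partial>M)"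
      unfolding eq by (subst Bochner_Integration.integral_diff[OF FT[OF k] ET[OF k]]) simp
  qed
  also have "\<dots> = (\<integral>x. (\<Sum>k=1..n. ?Fi x * DA \<alpha> k ?Fj x) \<partial>M)"
    by (rule Bochner_Integration.integral_sum[symmetric], rule FT)
  also have "\<dots> = (\<integral>x. ?Fi x * ?Fj x \<partial>M)"
  proof (rule integral_cong_AE)
    show "(\<lambda>x. \<Sum>k=1..n. ?Fi x * DA \<alpha> k ?Fj x) \<in> borel_measurable M"
      by (rule borel_measurable_sum, rule borel_measurable_integrable, rule FT)
    show "(\<lambda>x. ?Fi x * ?Fj x) \<in> borel_measurable M"
      by (rule borel_measurable_integrable, rule F_mult_integrable)
    show "AE x in M. (\<Sum>k=1..n. ?Fi x * DA \<alpha> k ?Fj x) = ?Fi x * ?Fj x"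
      using sum_DA[OF F_integrable[of j] F_G[of j], of \<alpha>]
      by eventually_elim (simp add: F_mean flip: sum_distrib_left)
  qed
  finally show "expectation (Z_alpha M S n X \<alpha> F i j) = expectation (\<lambda>x. F x $ i * F x $ j)" .
qed

lemma ennsqrt_Z_le:
  "ennsqrt (\<Sum>i\<in>UNIV. \<Sum>j\<in>UNIV. \<integral>\<^sup>+x. ennreal (\<bar>C $ i $ j - Z_alpha M S n X \<alpha> F i j x\<bar> ^ 2) \<partial>M)
    \<le> (\<Sum>i\<in>UNIV. \<Sum>j\<in>UNIV. ennreal \<bar>C $ i $ j - expectation (\<lambda>x. F x $ i * F x $ j)\<bar>)
      + (\<Sum>i\<in>UNIV. \<Sum>j\<in>UNIV. ennsqrt (evariance M (Z_alpha M S n X \<alpha> F i j)))"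
proof -
  have "ennsqrt (\<Sum>i\<in>UNIV. \<Sum>j\<in>UNIV. \<integral>\<^sup>+x. ennreal (\<bar>C $ i $ j - Z_alpha M S n X \<alpha> F i j x\<bar> ^ 2) \<partial>M)
    \<le> (\<Sum>i\<in>UNIV. \<Sum>j\<in>UNIV. ennreal \<bar>C $ i $ j - expectation (\<lambda>x. F x $ i * F x $ j)\<bar>
        + ennsqrt (evariance M (Z_alpha M S n X \<alpha> F i j)))"
    by (intro order_trans[OF ennsqrt_sum_le] sum_mono
          order_trans[OF ennsqrt_square_deviation_le[OF Z_mean(1)]]) (simp add: Z_mean(2))
  then show ?thesis by (simp add: sum.distrib)
qed

text \<open>The Frobenius norm is invariant under transposition and C is symmetric, so the transpose
  of Z can be traded for Z itself. The passage to squares is Cauchy-Schwarz.\<close>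

lemma nn_integral_norm_ZT_le:
  assumes C: "transpose C = C"
  shows "(\<integral>\<^sup>+x. ennreal (norm (ZT x - C)) \<partial>M)
    \<le> ennsqrt (\<Sum>i\<in>UNIV. \<Sum>j\<in>UNIV. \<integral>\<^sup>+x. ennreal (\<bar>C $ i $ j - Z_alpha M S n X \<alpha> F i j x\<bar> ^ 2) \<partial>M)"
proof -
  have sym: "C $ i $ j = C $ j $ i" for i j using C by (metis transpose_def vec_lambda_beta)
  have sq: "(norm (ZT x - C))\<^sup>2 = (\<Sum>j\<in>UNIV. \<Sum>i\<in>UNIV. \<bar>C $ i $ j - Z_alpha M S n X \<alpha> F i j x\<bar> ^ 2)" for x
  proof -
    have "(norm (ZT x - C))\<^sup>2 = (\<Sum>j\<in>UNIV. \<Sum>i\<in>UNIV. (Z_alpha M S n X \<alpha> F i j x - C $ j $ i)\<^sup>2)"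
      by (simp add: norm_vec_def L2_set_def sum_nonneg ZT_def)
    also have "\<dots> = (\<Sum>j\<in>UNIV. \<Sum>i\<in>UNIV. \<bar>C $ i $ j - Z_alpha M S n X \<alpha> F i j x\<bar> ^ 2)"
      by (intro sum.cong refl) (simp add: sym power2_commute)
    finally show ?thesis .
  qed
  note [measurable] = Z_measurable
  have "(\<integral>\<^sup>+x. ennreal (norm (ZT x - C)) \<partial>M) \<le> ennsqrt (\<integral>\<^sup>+x. ennreal ((norm (ZT x - C))\<^sup>2) \<partial>M)"
    using nn_integral_le_ennsqrt[OF ZT_measurable] by simp
  also have "(\<integral>\<^sup>+x. ennreal ((norm (ZT x - C))\<^sup>2) \<partial>M)
     = (\<integral>\<^sup>+x. (\<Sum>j\<in>UNIV. \<Sum>i\<in>UNIV. ennreal (\<bar>C $ i $ j - Z_alpha M S n X \<alpha> F i j x\<bar> ^ 2)) \<partial>M)"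
    unfolding sq by (simp add: sum_ennreal sum_nonneg)
  also have "\<dots> = (\<Sum>j\<in>UNIV. \<Sum>i\<in>UNIV. \<integral>\<^sup>+x. ennreal (\<bar>C $ i $ j - Z_alpha M S n X \<alpha> F i j x\<bar> ^ 2) \<partial>M)"
    by (simp add: nn_integral_sum del: sum_ennreal)
  also have "\<dots> = (\<Sum>i\<in>UNIV. \<Sum>j\<in>UNIV. \<integral>\<^sup>+x. ennreal (\<bar>C $ i $ j - Z_alpha M S n X \<alpha> F i j x\<bar> ^ 2) \<partial>M)"
    by (rule sum.swap)
  finally show ?thesis .
qed

text \<open>Bounding |TF| by the sum of its coordinates gives d^2 products. Young's inequality
  splits each into two cubes, and each cube leaves one summation index free, whence the factor d.
  The contraction bound then replaces the cubes of \<open>TF\<close> by those of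
  \<open>DF\<close>.\<close>

lemma nn_integral_remainder_le:
  assumes k: "k \<in> {1..n}"
  shows "(\<integral>\<^sup>+x. ennreal (norm (TF k x) * (norm (DF k x))\<^sup>2) \<partial>M)
    \<le> of_nat CARD('d) * (\<Sum>i\<in>UNIV. \<integral>\<^sup>+x. ennreal (\<bar>D k (\<lambda>x. F x $ i) x\<bar> ^ 3) \<partial>M)"
proof -
  let ?y = "\<lambda>i. \<integral>\<^sup>+x. ennreal (\<bar>D k (\<lambda>x. F x $ i) x\<bar> ^ 3) \<partial>M"
  have [measurable]: "(\<lambda>x. TF k x $ i) \<in> borel_measurable M" "(\<lambda>x. DF k x $ i) \<in> borel_measurable M" for i
    using TF_integrable[OF k] DF_integrable by auto
  have pw: "norm (TF k x) * (norm (DF k x))\<^sup>2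
      \<le> (\<Sum>j\<in>UNIV. \<Sum>i\<in>UNIV. 1 / 3 * \<bar>TF k x $ j\<bar> ^ 3 + 2 / 3 * \<bar>DF k x $ i\<bar> ^ 3)" for x
  proof -
    have "norm (TF k x) * (norm (DF k x))\<^sup>2 \<le> (\<Sum>j\<in>UNIV. \<bar>TF k x $ j\<bar>) * (norm (DF k x))\<^sup>2"
      by (intro mult_right_mono norm_le_l1_cart) auto
    also have "\<dots> = (\<Sum>j\<in>UNIV. \<bar>TF k x $ j\<bar>) * (\<Sum>i\<in>UNIV. \<bar>DF k x $ i\<bar>\<^sup>2)"
      by (simp add: norm_vec_def L2_set_def sum_nonneg)
    also have "(\<Sum>j\<in>UNIV. \<bar>TF k x $ j\<bar>) * (\<Sum>i\<in>UNIV. \<bar>DF k x $ i\<bar>\<^sup>2) = (\<Sum>j\<in>UNIV. \<Sum>i\<in>UNIV. \<bar>TF k x $ j\<bar> * \<bar>DF k x $ i\<bar>\<^sup>2)"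
      by (rule sum_product)
    also have "\<dots> \<le> (\<Sum>j\<in>UNIV. \<Sum>i\<in>UNIV. 1 / 3 * \<bar>TF k x $ j\<bar> ^ 3 + 2 / 3 * \<bar>DF k x $ i\<bar> ^ 3)"
      by (intro sum_mono Young_cubic) auto
    finally show ?thesis .
  qed
  have "(\<integral>\<^sup>+x. ennreal (norm (TF k x) * (norm (DF k x))\<^sup>2) \<partial>M)
      \<le> (\<integral>\<^sup>+x. (\<Sum>j\<in>UNIV. \<Sum>i\<in>UNIV. ennreal (1 / 3) * ennreal (\<bar>TF k x $ j\<bar> ^ 3) + ennreal (2 / 3) * ennreal (\<bar>DF k x $ i\<bar> ^ 3)) \<partial>M)"
  proof (rule nn_integral_mono)
    fix x
    have "ennreal (norm (TF k x) * (norm (DF k x))\<^sup>2)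
      \<le> ennreal (\<Sum>j\<in>UNIV. \<Sum>i\<in>UNIV. 1 / 3 * \<bar>TF k x $ j\<bar> ^ 3 + 2 / 3 * \<bar>DF k x $ i\<bar> ^ 3)"
      by (rule ennreal_leI[OF pw])
    also have "\<dots> = (\<Sum>j\<in>UNIV. \<Sum>i\<in>UNIV. ennreal (1 / 3 * \<bar>TF k x $ j\<bar> ^ 3 + 2 / 3 * \<bar>DF k x $ i\<bar> ^ 3))"
      by (simp add: sum_ennreal sum_nonneg del: ennreal_plus)
    also have "\<dots> = (\<Sum>j\<in>UNIV. \<Sum>i\<in>UNIV. ennreal (1 / 3) * ennreal (\<bar>TF k x $ j\<bar> ^ 3) + ennreal (2 / 3) * ennreal (\<bar>DF k x $ i\<bar> ^ 3))"
      by (intro sum.cong refl, subst ennreal_plus) (auto simp only: ennreal_mult zero_le_power abs_ge_zero intro!: mult_nonneg_nonneg)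
    finally show "ennreal (norm (TF k x) * (norm (DF k x))\<^sup>2) \<le> \<dots>" .
  qed
  also have "\<dots> = (\<Sum>j\<in>UNIV. \<Sum>i\<in>UNIV. ennreal (1 / 3) * (\<integral>\<^sup>+x. ennreal (\<bar>TF k x $ j\<bar> ^ 3) \<partial>M) + ennreal (2 / 3) * (\<integral>\<^sup>+x. ennreal (\<bar>DF k x $ i\<bar> ^ 3) \<partial>M))"
    by (simp only: nn_integral_sum nn_integral_add nn_integral_cmult borel_measurable_sum borel_measurable_add
        borel_measurable_times_ennreal borel_measurable_const measurable_compose[OF _ measurable_ennreal]
        borel_measurable_power borel_measurable_abs \<open>(\<lambda>x. TF k x $ _) \<in> borel_measurable M\<close> \<open>(\<lambda>x. DF k x $ _) \<in> borel_measurable M\<close>)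
  also have "\<dots> \<le> (\<Sum>j\<in>UNIV. \<Sum>i\<in>UNIV. ennreal (1 / 3) * ?y j + ennreal (2 / 3) * ?y i)"
    using nn_integral_DA_power_le[OF F_integrable k \<alpha>, of _ 3]
    by (intro sum_mono add_mono mult_left_mono) (auto simp: TF_def DF_def)
  also have "\<dots> = ennreal (1 / 3) * (of_nat CARD('d) * (\<Sum>i\<in>UNIV. ?y i)) + ennreal (2 / 3) * (of_nat CARD('d) * (\<Sum>i\<in>UNIV. ?y i))"
    by (simp add: sum.distrib mult.left_commute flip: sum_distrib_left)
  also have "\<dots> = of_nat CARD('d) * (\<Sum>i\<in>UNIV. ?y i)"
    by (simp flip: distrib_right ennreal_plus)
  finally show ?thesis .
qed

section \<open>Integration along the interpolation path\<close>

lemma normA_integrable: "integrable \<gamma> (\<lambda>z. norm (A *v z))"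
proof (rule norm_vec_integrable)
  fix i
  have "(\<lambda>z. (A *v z) $ i) = (\<lambda>z. z \<bullet> A $ i)"
    by (simp add: fun_eq_iff matrix_vector_mult_def inner_vec_def mult.commute)
  then show "integrable \<gamma> (\<lambda>z. (A *v z) $ i)" by (simp add: std_gaussian_inner)
qed

lemma g_measurable [measurable]: "g \<in> borel_measurable borel"
  by (intro borel_measurable_continuous_onI differentiable_imp_continuous_on)
     (simp add: differentiable_on_def g_diff differentiable_at_withinI)

text \<open>The product of \<open>M\<close> with the Gaussian measure provides an independent copy
  of Y; only the law of Y matters. The path runs from A z at t = 0 to F at t = pi/2, and - cos t * Q
  is a primitive of the derivative bound, with total increment \<open>Q\<close>.\<close>

lemma interpolation:
  assumes C: "C = A ** transpose A"
    and Q: "\<And>s c. 0 \<le> s \<Longrightarrow> s \<le> 1 \<Longrightarrow> 0 < c \<Longrightarrow>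
      \<bar>\<integral>x. c * (mean_grad s c (F x) \<bullet> F x) - s * (\<Sum>i\<in>UNIV. \<Sum>j\<in>UNIV. W s c (F x) i j * C $ i $ j) \<partial>M\<bar> \<le> s * Q"
  shows "\<bar>(\<integral>x. g (F x) \<partial>M) - (\<integral>z. g (A *v z) \<partial>\<gamma>)\<bar> \<le> Q"
proof -
  interpret P: pair_prob_space M \<gamma> by unfold_locales
  let ?P = "M \<Otimes>\<^sub>M \<gamma>"
  define U where "U t p = sin t *\<^sub>R F (fst p) + cos t *\<^sub>R (A *v snd p)" for t p
  define U' where "U' t p = cos t *\<^sub>R F (fst p) - sin t *\<^sub>R (A *v snd p)" for t p
  \<comment> \<open>A majorant of the path and of its velocity, uniform in t; multiplied by
    \<open>L\<close> it yields the constant \<open>D\<close> needed for Fubini.\<close>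
  define N where "N p = norm (F (fst p)) + norm (A *v snd p)" for p
  have A[measurable]: "(\<lambda>z. A *v z) \<in> borel_measurable \<gamma>" by measurable
  have [measurable]: "(\<lambda>p. A *v snd p) \<in> borel_measurable ?P"
    "(\<lambda>p. A *v snd (snd p)) \<in> borel_measurable (borel \<Otimes>\<^sub>M ?P)"
    by (rule measurable_compose[OF _ A], measurable)+
  have FI: "integrable M (\<lambda>x. norm (F x))" by (rule norm_vec_integrable[OF F_integrable])
  have NI: "integrable ?P N"
    unfolding N_def
  proof (rule Bochner_Integration.integrable_add)
    show "integrable ?P (\<lambda>p. norm (F (fst p)))"
      by (rule P.Fubini_integrable) (use FI in \<open>auto simp: gauss.prob_space[simplified]\<close>)
    show "integrable ?P (\<lambda>p. norm (A *v snd p))"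
      by (rule P.Fubini_integrable) (use normA_integrable in auto)
  qed
  have N0: "0 \<le> N p" for p by (simp add: N_def)
  have Ub: "norm (U t p) \<le> N p" "norm (U' t p) \<le> N p" for t p
  proof -
    have "\<bar>sin t\<bar> * a \<le> a" "\<bar>cos t\<bar> * a \<le> a" if "0 \<le> a" for a
      using that by (auto intro!: mult_left_le_one_le)
    then show "norm (U t p) \<le> N p" "norm (U' t p) \<le> N p"
      unfolding U_def U'_def N_def
      by (auto intro!: order_trans[OF norm_triangle_ineq] order_trans[OF norm_triangle_ineq4] add_mono)
  qed
  have Um[measurable]: "(\<lambda>p. U t p) \<in> borel_measurable ?P" "(\<lambda>p. U' t p) \<in> borel_measurable ?P" for t
    unfolding U_def U'_def by measurable
  let ?f = "\<lambda>t p. g (U t p)" and ?f' = "\<lambda>t p. gradient g (U t p) \<bullet> U' t p"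
  have fI: "integrable ?P (?f t)" for t
  proof (rule Bochner_Integration.integrable_bound)
    show "integrable ?P (\<lambda>p. \<bar>g 0\<bar> + L * N p)" using NI by simp
    have "\<bar>g (U t p)\<bar> \<le> \<bar>g 0\<bar> + L * N p" for p
      using g_lip[of "U t p" 0] mult_left_mono[OF Ub(1)[of t p] nonneg(1)] by simp
    then show "AE p in ?P. norm (g (U t p)) \<le> norm (\<bar>g 0\<bar> + L * N p)"
      by (intro AE_I2) (unfold real_norm_def, rule order_trans[OF _ abs_ge_self])
  qed measurable
  have f'b: "\<bar>?f' t p\<bar> \<le> L * N p" for t p
    by (rule order_trans[OF Cauchy_Schwarz_ineq2]) (intro mult_mono grad_bound Ub nonneg norm_ge_zero)
  have f'I: "integrable ?P (?f' t)" for t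
  proof (rule Bochner_Integration.integrable_bound)
    show "integrable ?P (\<lambda>p. L * N p)" using NI by simp
    show "AE p in ?P. norm (?f' t p) \<le> norm (L * N p)"
      by (intro AE_I2) (unfold real_norm_def, rule order_trans[OF f'b abs_ge_self])
  qed measurable
  have inner: "(\<integral>z. ?f' t (x, z) \<partial>\<gamma>) = cos t * (mean_grad (sin t) (cos t) (F x) \<bullet> F x)
       - sin t * (\<Sum>i\<in>UNIV. \<Sum>j\<in>UNIV. W (sin t) (cos t) (F x) i j * C $ i $ j)" for t x
  proof -
    let ?V = "V (sin t) (cos t) (F x)"
    have VA: "integrable \<gamma> (\<lambda>z. ?V z \<bullet> (A *v z))"
    proof (rule Bochner_Integration.integrable_bound)
      show "integrable \<gamma> (\<lambda>z. L * norm (A *v z))" using normA_integrable by simp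
      show "AE z in \<gamma>. norm (?V z \<bullet> (A *v z)) \<le> norm (L * norm (A *v z))"
        using V_bound(3) nonneg by (auto simp: abs_mult)
    qed measurable
    have "(\<lambda>z. ?f' t (x, z)) = (\<lambda>z. cos t * (?V z \<bullet> F x) - sin t * (?V z \<bullet> (A *v z)))"
      by (simp add: fun_eq_iff U_def U'_def V_def inner_diff_right)
    then have "(\<integral>z. ?f' t (x, z) \<partial>\<gamma>) = cos t * (\<integral>z. ?V z \<bullet> F x \<partial>\<gamma>) - sin t * (\<integral>z. ?V z \<bullet> (A *v z) \<partial>\<gamma>)"
      using VA V_integrable(2) by simp
    then show ?thesis by (simp add: mean_grad_inner sum_W_covariance[OF C])
  qed
  have "\<bar>(\<integral>p. ?f (pi / 2) p \<partial>?P) - (\<integral>p. ?f 0 p \<partial>?P)\<bar> \<le> - cos (pi / 2) * Q - - cos 0 * Q"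
  proof (rule integral_increment_bound[where f'="?f'" and D="\<integral>p. L * N p \<partial>?P" and h="\<lambda>t. sin t * Q"])
    show "sigma_finite_measure ?P" ..
    show "((\<lambda>t. ?f t p) has_real_derivative ?f' t p) (at t)" for t p
    proof -
      have U: "((\<lambda>t. U t p) has_derivative (\<lambda>h. h *\<^sub>R U' t p)) (at t)"
        unfolding U_def U'_def
        by (auto intro!: derivative_eq_intros simp: algebra_simps)
      have "((\<lambda>t. g (U t p)) has_derivative (\<lambda>h. gradient g (U t p) \<bullet> (h *\<^sub>R U' t p))) (at t)"
        by (rule has_derivative_compose[OF U gradient_derivative[OF g_diff]])
      then show ?thesis unfolding has_field_derivative_def
        by (rule has_derivative_eq_rhs) (simp add: fun_eq_iff)
    qed
    show "continuous_on {0..pi / 2} (\<lambda>t. ?f' t p)" for p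
      unfolding U_def U'_def
      by (intro continuous_intros continuous_on_compose2[OF grad_cont]) auto
    show "(\<lambda>(t, p). ?f' t p) \<in> borel_measurable (borel \<Otimes>\<^sub>M ?P)"
      unfolding U_def U'_def split_def by measurable
    show "(\<integral>p. \<bar>?f' t p\<bar> \<partial>?P) \<le> (\<integral>p. L * N p \<partial>?P)" for t
      using f'b NI f'I by (intro integral_mono) auto
    \<comment> \<open>The open interval guarantees cos t > 0, as the assumed bound requires; at t =
      pi/2 the Gaussian smoothing disappears.\<close>
    show "\<bar>\<integral>p. ?f' t p \<partial>?P\<bar> \<le> sin t * Q" if "0 < t" "t < pi / 2" for t
    proof -
      have "(\<integral>p. ?f' t p \<partial>?P) = (\<integral>x. (\<integral>z. ?f' t (x, z) \<partial>\<gamma>) \<partial>M)"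
        by (rule P.integral_fst'[symmetric, OF f'I])
      then show ?thesis unfolding inner
        using Q[of "sin t" "cos t"] that by (simp add: sin_ge_zero cos_gt_zero)
    qed
    show "((\<lambda>t. - cos t * Q) has_real_derivative sin t * Q) (at t)" for t
      by (auto intro!: derivative_eq_intros)
    show "continuous_on {0..pi / 2} (\<lambda>t. sin t * Q)" by (intro continuous_intros)
  qed (use fI f'I in auto)
  also have "(\<integral>p. ?f (pi / 2) p \<partial>?P) = (\<integral>x. g (F x) \<partial>M)"
    using P.integral_fst'[OF fI[of "pi / 2"]] by (simp add: U_def gauss.prob_space[simplified])
  also have "(\<integral>p. ?f 0 p \<partial>?P) = (\<integral>z. g (A *v z) \<partial>\<gamma>)"
    using P.integral_fst'[OF fI[of 0]] by (simp add: U_def prob_space)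
  finally show ?thesis by simp
qed

lemma gaussian_comparison_bound:
  assumes C: "C = A ** transpose A"
  shows "ennreal \<bar>(\<integral>x. g (F x) \<partial>M) - (\<integral>z. g (A *v z) \<partial>\<gamma>)\<bar> \<le> stein_bound C"
proof (cases "stein_bound C")
  case (real q)
  have "\<bar>(\<integral>x. g (F x) \<partial>M) - (\<integral>z. g (A *v z) \<partial>\<gamma>)\<bar> \<le> q"
  proof (rule interpolation[OF C])
    fix s c :: real assume s: "0 \<le> s" "s \<le> 1" and c: "0 < c"
    show "\<bar>\<integral>x. c * (mean_grad s c (F x) \<bullet> F x) - s * (\<Sum>i\<in>UNIV. \<Sum>j\<in>UNIV. W s c (F x) i j * C $ i $ j) \<partial>M\<bar> \<le> s * q"
      using stein_identity_bound[OF s c, of C] s real by (simp add: ennreal_mult[symmetric])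
  qed
  then show ?thesis by (simp add: real ennreal_leI)
qed simp

end

theorem theorem3p1:
  fixes M :: "'a measure" and S :: "'x measure" and N :: "'b measure"
    and X :: "nat \<Rightarrow> 'a \<Rightarrow> 'x" and n :: nat
    and C :: "real ^ 'd ^ 'd" and Y :: "'b \<Rightarrow> real ^ 'd"
    and f :: "'d \<Rightarrow> (nat \<Rightarrow> 'x) \<Rightarrow> real" and F :: "'a \<Rightarrow> real ^ 'd"
    and \<alpha> :: real and g :: "real ^ 'd \<Rightarrow> real"
  assumes "CARD('d) \<ge> 2" and "n \<ge> 1"
    and "prob_space M" and "prob_space N"
    and "prob_space.indep_vars M (\<lambda>_. S) X {1..n}"
    and "positive_definite C"
    and "gaussian_vector N Y" and "centered N Y" and "has_covariance_matrix N Y C"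
    and "\<And>i. f i \<in> borel_measurable (Pi\<^sub>M {1..n} (\<lambda>_. S))"
    and "\<And>\<omega>. F \<omega> = (\<chi> i. f i (\<lambda>k\<in>{1..n}. X k \<omega>))"
    and "\<And>i. integral\<^sup>L M (\<lambda>\<omega>. F \<omega> $ i) = 0"
    and "\<And>i j. integrable M (\<lambda>\<omega>. F \<omega> $ i * F \<omega> $ j)"
    and "0 \<le> \<alpha>" and "\<alpha> \<le> 1"
    and "twice_cont_diff g" and "lip_const g + M2 g < \<infinity>"
  shows
    "ennreal \<bar>integral\<^sup>L M (\<lambda>\<omega>. g (F \<omega>)) - integral\<^sup>L N (\<lambda>\<omega>. g (Y \<omega>))\<bar>
       \<le> B1 C g * ennsqrt (\<Sum>i\<in>UNIV. \<Sum>j\<in>UNIV.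
             \<integral>\<^sup>+ \<omega>. ennreal (\<bar>C $ i $ j - Z_alpha M S n X \<alpha> F i j \<omega>\<bar> ^ 2) \<partial>M)
         + B2 C g * (\<Sum>i\<in>UNIV. \<Sum>k=1..n.
             \<integral>\<^sup>+ \<omega>. ennreal (\<bar>diff_op M S n X k (\<lambda>\<omega>. F \<omega> $ i) \<omega>\<bar> ^ 3) \<partial>M) \<and>
     B1 C g * ennsqrt (\<Sum>i\<in>UNIV. \<Sum>j\<in>UNIV.
             \<integral>\<^sup>+ \<omega>. ennreal (\<bar>C $ i $ j - Z_alpha M S n X \<alpha> F i j \<omega>\<bar> ^ 2) \<partial>M)
         + B2 C g * (\<Sum>i\<in>UNIV. \<Sum>k=1..n.
             \<integral>\<^sup>+ \<omega>. ennreal (\<bar>diff_op M S n X k (\<lambda>\<omega>. F \<omega> $ i) \<omega>\<bar> ^ 3) \<partial>M)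
       \<le> B1 C g * (\<Sum>i\<in>UNIV. \<Sum>j\<in>UNIV.
             ennreal \<bar>C $ i $ j - integral\<^sup>L M (\<lambda>\<omega>. F \<omega> $ i * F \<omega> $ j)\<bar>)
         + B1 C g * (\<Sum>i\<in>UNIV. \<Sum>j\<in>UNIV. ennsqrt (evariance M (Z_alpha M S n X \<alpha> F i j)))
         + B2 C g * (\<Sum>i\<in>UNIV. \<Sum>k=1..n.
             \<integral>\<^sup>+ \<omega>. ennreal (\<bar>diff_op M S n X k (\<lambda>\<omega>. F \<omega> $ i) \<omega>\<bar> ^ 3) \<partial>M)"
proof -
  note d2 = assms(1) and M = assms(3) and N = assms(4) and ind = assms(5) and pd = assms(6)
    and f = assms(10) and F = assms(11) and tcd = assms(16)
  define L where "L = enn2real (lip_const g)"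
  define L2 where "L2 = enn2real (M2 g)"
  define K where "K = sqrt (opnorm (matrix_inv C))"
  have lip: "lip_const g < \<top>" "M2 g < \<top>"
    using assms(17) by (auto simp: less_top[symmetric])
  then have L: "lip_const g = ennreal L" "M2 g = ennreal L2" by (simp_all add: L_def L2_def)
  have nonneg: "0 \<le> L" "0 \<le> L2" "0 \<le> K" by (simp_all add: L_def L2_def K_def opnorm_nonneg)
  have invC: "invertible C" by (rule positive_definite_invertible[OF pd])
  have sym: "transpose C = C" using pd by (simp add: positive_definite_def)
  obtain A :: "real^'d^'d" where C: "C = A ** transpose A"
    and Y: "distr N borel Y = distr std_gaussian borel (\<lambda>z. A *v z)"
    by (rule gaussian_covariance_factor[OF assms(7-9)])
  \<comment> \<open>Since A A^T C^-1 is the identity and \<open>A\<close> is square, this matrix is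
    the inverse of \<open>A\<close>.\<close>
  define a where "a = transpose A ** matrix_inv C"
  have Aa: "A ** a = mat 1"
    using matrix_inv_inverse(1)[OF invC] by (simp add: a_def matrix_mul_assoc flip: C)
  interpret prob_space M by fact
  have ind': "indep_vars (\<lambda>_. S) X {1..n}" using ind .
  interpret finite_independent_family M S X n by unfold_locales (rule ind')
  have FG: "(\<lambda>x. F x $ i) \<in> borel_measurable (sigma_gen M S X {1..n})" for i
  proof -
    \<comment> \<open>Measurability is needed for the sigma-algebra generated by the variables, not
      just for \<open>M\<close>, so that F is its own conditional expectation at the end of the
      telescoping sum.\<close>
    have "(\<lambda>x. \<lambda>k\<in>{1..n}. X k x) \<in> measurable (sigma_gen M S X {1..n}) (Pi\<^sub>M {1..n} (\<lambda>_. S))"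
      by (rule measurable_restrict) (rule X_measurable_G, auto)
    from measurable_compose[OF this f[of i]] show ?thesis by (simp add: F)
  qed
  interpret gaussian_comparison M S X n g A a L L2 K F \<alpha>
  proof unfold_locales
    show "g differentiable (at x)" for x using tcd by (simp add: twice_cont_diff_def)
    show "continuous_on UNIV (gradient g)"
      using tcd by (intro differentiable_imp_continuous_on)
        (simp add: twice_cont_diff_def differentiable_on_def differentiable_at_withinI)
    show "\<bar>g x - g y\<bar> \<le> L * norm (x - y)" for x y
      using lip_const_bound[OF lip(1), of x y] by (simp add: L_def)
    show "norm (gradient g x - gradient g y) \<le> L2 * norm (x - y)" for x y
      using lip_const_bound[of "gradient g" x y] lip(2) by (simp add: L2_def M2_def)
    show "norm (a *v w) \<le> K * norm w" for w
      unfolding K_def by (rule norm_inverse_factor_le[OF C invC Aa])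
    show "integrable M (\<lambda>x. (F x $ i)\<^sup>2)" for i
      using assms(13)[of i i] by (simp add: power2_eq_square)
  qed (fact Aa nonneg FG assms(12,14,15))+
  let ?T1 = "ennsqrt (\<Sum>i\<in>UNIV. \<Sum>j\<in>UNIV. \<integral>\<^sup>+ \<omega>. ennreal (\<bar>C $ i $ j - Z_alpha M S n X \<alpha> F i j \<omega>\<bar> ^ 2) \<partial>M)"
  let ?y = "\<lambda>i k. \<integral>\<^sup>+ \<omega>. ennreal (\<bar>diff_op M S n X k (\<lambda>\<omega>. F \<omega> $ i) \<omega>\<bar> ^ 3) \<partial>M"
  let ?T3 = "\<Sum>i\<in>UNIV. \<Sum>k=1..n. ?y i k"
  have B1: "ennreal (L * K) \<le> B1 C g"
  proof -
    have "L * K \<le> L * (opnorm (matrix_inv C) * sqrt (opnorm C))"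
      unfolding K_def by (intro mult_left_mono sqrt_opnorm_le(1)[OF invC] nonneg)
    then have "ennreal (L * K) \<le> ennreal (opnorm (matrix_inv C) * sqrt (opnorm C) * L)"
      by (intro ennreal_leI) (simp add: mult.commute)
    also have "\<dots> = B1 C g"
      unfolding B1_def L by (intro ennreal_mult mult_nonneg_nonneg real_sqrt_ge_zero opnorm_nonneg nonneg)
    finally show ?thesis .
  qed
  \<comment> \<open>The factor d from the remainder estimate joins the constant here and is absorbed
    into the d^2 of \<open>B2\<close>.\<close>
  have B2: "ennreal (L2 * K) * of_nat CARD('d) \<le> B2 C g"
  proof -
    let ?c = "sqrt (2 * pi) / 4 * opnorm (matrix_inv C) powr (3 / 2) * opnorm C"
    have "ennreal (L2 * K) * of_nat CARD('d) = ennreal (L2 * (K * real CARD('d)))"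
      using nonneg by (simp add: ennreal_of_nat_eq_real_of_nat ennreal_mult mult.assoc)
    also have "\<dots> \<le> ennreal (L2 * (?c * real (CARD('d) ^ 2)))"
      unfolding K_def by (intro ennreal_leI mult_left_mono sqrt_opnorm_le(2)[OF invC d2] nonneg)
    also have "\<dots> = ennreal (?c * L2 * real (CARD('d) ^ 2))" by (simp add: ac_simps)
    also have "\<dots> = B2 C g"
      unfolding B2_def L ennreal_of_nat_eq_real_of_nat
      using nonneg opnorm_nonneg[of C] by (subst ennreal_mult[symmetric], simp, simp)+ simp
    finally show ?thesis .
  qed
  have [measurable]: "Y \<in> borel_measurable N" using assms(7) by (simp add: gaussian_vector_def)
  have "(\<integral>\<omega>. g (Y \<omega>) \<partial>N) = (\<integral>y. g y \<partial>distr N borel Y)" by (subst integral_distr) auto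
  also have "\<dots> = (\<integral>z. g (A *v z) \<partial>std_gaussian)" unfolding Y by (subst integral_distr) auto
  finally have gY: "(\<integral>\<omega>. g (Y \<omega>) \<partial>N) = (\<integral>z. g (A *v z) \<partial>std_gaussian)" .
  have "ennreal \<bar>(\<integral>\<omega>. g (F \<omega>) \<partial>M) - (\<integral>\<omega>. g (Y \<omega>) \<partial>N)\<bar> \<le> stein_bound C"
    unfolding gY by (rule gaussian_comparison_bound[OF C])
  also have "stein_bound C \<le> B1 C g * ?T1 + B2 C g * ?T3"
    unfolding stein_bound_def
  proof (rule add_mono)
    show "ennreal (L * K) * (\<integral>\<^sup>+x. ennreal (norm (ZT x - C)) \<partial>M) \<le> B1 C g * ?T1"
      by (intro mult_mono B1 nn_integral_norm_ZT_le sym) auto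
    have "(\<Sum>k=1..n. \<integral>\<^sup>+x. ennreal (norm (TF k x) * (norm (DF k x))\<^sup>2) \<partial>M)
      \<le> (\<Sum>k=1..n. of_nat CARD('d) * (\<Sum>i\<in>UNIV. ?y i k))"
      by (intro sum_mono nn_integral_remainder_le)
    also have "\<dots> = of_nat CARD('d) * ?T3"
      unfolding sum_distrib_left[symmetric] by (subst sum.swap) simp
    finally have "ennreal (L2 * K) * (\<Sum>k=1..n. \<integral>\<^sup>+x. ennreal (norm (TF k x) * (norm (DF k x))\<^sup>2) \<partial>M)
      \<le> ennreal (L2 * K) * (of_nat CARD('d) * ?T3)"
      by (intro mult_left_mono) auto
    also have "\<dots> = (ennreal (L2 * K) * of_nat CARD('d)) * ?T3" by (simp only: mult.assoc)
    also have "\<dots> \<le> B2 C g * ?T3" by (intro mult_right_mono B2) auto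
    finally show "ennreal (L2 * K) * (\<Sum>k=1..n. \<integral>\<^sup>+x. ennreal (norm (TF k x) * (norm (DF k x))\<^sup>2) \<partial>M) \<le> B2 C g * ?T3" .
  qed
  finally have first: "ennreal \<bar>(\<integral>\<omega>. g (F \<omega>) \<partial>M) - (\<integral>\<omega>. g (Y \<omega>) \<partial>N)\<bar> \<le> B1 C g * ?T1 + B2 C g * ?T3" .
  have "B1 C g * ?T1 \<le> B1 C g * ((\<Sum>i\<in>UNIV. \<Sum>j\<in>UNIV. ennreal \<bar>C $ i $ j - integral\<^sup>L M (\<lambda>\<omega>. F \<omega> $ i * F \<omega> $ j)\<bar>)
         + (\<Sum>i\<in>UNIV. \<Sum>j\<in>UNIV. ennsqrt (evariance M (Z_alpha M S n X \<alpha> F i j))))"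
    by (intro mult_left_mono ennsqrt_Z_le) auto
  then have "B1 C g * ?T1 + B2 C g * ?T3 \<le> B1 C g * (\<Sum>i\<in>UNIV. \<Sum>j\<in>UNIV. ennreal \<bar>C $ i $ j - integral\<^sup>L M (\<lambda>\<omega>. F \<omega> $ i * F \<omega> $ j)\<bar>)
         + B1 C g * (\<Sum>i\<in>UNIV. \<Sum>j\<in>UNIV. ennsqrt (evariance M (Z_alpha M S n X \<alpha> F i j))) + B2 C g * ?T3"
    unfolding distrib_left by (rule add_right_mono)
  with first show ?thesis by (rule conjI)
qed

end
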